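(* Let $F^n=(M^n,L)$ be a Finsler space, $b_i(x,y)$ an $h$-vector in $F^n$, and let $\overline F^n=(M^n,\overline L)$ be the Finsler space obtained from $F^n$ by the $h$-Matsumoto change $\overline L=\dfrac{L^2}{L-\beta}$, $\beta=b_i(x,y)y^i$. Let $F^{n-1}$ and $\overline F^{n-1}$ be the hypersurfaces of $F^n$ and $\overline F^n$, respectively, determined by the same hypersurface $M^{n-1}$ of $M^n$. Suppose that $b_i(x,y)$ is parallel with respect to the Cartan connection of $F^n$ and tangent to the hypersurface $F^{n-1}$. Then $\overline F^{n-1}$ is a hyperplane of the second kind if and only if $F^{n-1}$ is a hyperplane of the second kind; and $\overline F^{n-1}$ is a hyperplane of the third kind if and only if $F^{n-1}$ is a hyperplane of the third kind.
   Context: Conventions: $\partial_i=\partial/\partial x^i$, $\dot\partial_i=\partial/\partial y^i$; Latin indices run over $1,\dots,n$, Greek indices over $1,\dots,n-1$; repeated indices are summed. Finsler space: $F^n=(M^n,L)$ is an $n$-dimensional smooth manifold with a fundamental function $L(x,y)$: positive and smooth for $y\neq 0$, positively homogeneous of degree one in $y$, with positive definite metric tensor $g_{ij}=\frac12\dot\partial_i\dot\partial_j L^2$. Let $g^{ij}$ be the inverse of $g_{ij}$, $l_i=\dot\partial_iL$, $h_{ij}=L\dot\partial_i\dot\partial_jL=g_{ij}-l_il_j$ the angular metric tensor, $C_{ijk}=\frac12\dot\partial_kg_{ij}$ the Cartan tensor, and $C^h_{ij}=g^{hk}C_{ijk}$. Cartan connection $C\Gamma=(F^i_{jk},G^i_j,C^i_{jk})$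 of $F^n$: $G^i=\frac14g^{ij}(y^r\dot\partial_j\partial_rL^2-\partial_jL^2)$, $G^i_j=\dot\partial_jG^i$, $\delta_j=\partial_j-G^r_j\dot\partial_r$, $F^i_{jk}=\frac12g^{ih}(\delta_jg_{hk}+\delta_kg_{hj}-\delta_hg_{jk})$. The $h$- and $v$-covariant derivatives of a covector $b_i$ are $b_{i|j}=\delta_jb_i-b_rF^r_{ij}$ and $b_i|_j=\dot\partial_jb_i-b_rC^r_{ij}$. $h$-vector: a covariant vector field $b_i(x,y)$ is an $h$-vector in $F^n$ if (i) $b_i|_k=0$ and (ii) $L\,C^h_{ij}b_h=\rho\,h_{ij}$ for a non-zero scalar function $\rho$. It is parallel with respect to the Cartan connection of $F^n$ if $b_{i|j}=0$. It is assumed that $\overline L$ is itself the fundamental function of a Finsler space (in particular $L-\beta$ does not vanish). Barred quantities are formed from $\overline L$ in the same way as unbarred ones from $L$. Hypersurfaces: $M^{n-1}$ is given parametrically by $x^i=x^i(u^\alpha)$ with $B^i_\alpha=\partial x^i/\partial u^\alpha$ of rank $n-1$. The supporting element is taken tangent to $M^{n-1}$: $y^i=B^i_\alpha(u)v^\alpha$, $v\ne0$. Then $F^{n-1}=(M^{n-1},\underline L)$ with $\underline L(u,v)=L(x(u),y(u,v))$, and $\overline F^{n-1}$ is obtained in the same way from $\overline L$. The unit normal vector $B^i(u,v)$ of $F^{n-1}$ is defined by $g_{ij}B^i_\alpha B^j=0$, $g_{ij}B^iB^j=1$, and $B_i=g_{ij}B^j$; likewise $\overline B^i$ is defined by $\overline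 g_{ij}B^i_\alpha\overline B^j=0$, $\overline g_{ij}\overline B^i\overline B^j=1$, and $\overline B_i=\overline g_{ij}\overline B^j$. The vector $b_i$ is tangent to $F^{n-1}$ if $b_iB^i=0$ along $F^{n-1}$. Put $B^i_{\alpha\beta}=\dfrac{\partial^2x^i}{\partial u^\alpha\partial u^\beta}$, $B^i_{0\alpha}=B^i_{\beta\alpha}v^\beta$, and $$H_\alpha=B_i(B^i_{0\alpha}+G^i_jB^j_\alpha),\quad M_\alpha=C_{ijk}B^i_\alpha B^jB^k,\quad M_{\alpha\beta}=C_{ijk}B^iB^j_\alpha B^k_\beta,$$ $$H_{\alpha\beta}=B_i(B^i_{\alpha\beta}+F^i_{jk}B^j_\alpha B^k_\beta)+M_\alpha H_\beta .$$ $F^{n-1}$ is a hyperplane of the second kind if $H_{\alpha\beta}=0$, and of the third kind if $H_{\alpha\beta}=0=M_{\alpha\beta}$. The same definitions with barred quantities apply to $\overline F^{n-1}$. *)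

theory Defs
  imports "HOL-Analysis.Analysis"
begin

section \<open>Smooth manifolds, given by an atlas\<close>

text \<open>The following two notions are meant for open sets \<open>S\<close>.\<close>

primrec C_k_on :: "nat \<Rightarrow> 'a::real_normed_vector set \<Rightarrow> ('a \<Rightarrow> 'b::real_normed_vector) \<Rightarrow> bool" where
  "C_k_on 0 S f \<longleftrightarrow> continuous_on S f"
| "C_k_on (Suc k) S f \<longleftrightarrow> (\<forall>x\<in>S. f differentiable (at x)) \<and>
     (\<forall>v. C_k_on k S (\<lambda>x. frechet_derivative f (at x) v))"

definition smooth_on :: "'a::real_normed_vector set \<Rightarrow> ('a \<Rightarrow> 'b::real_normed_vector) \<Rightarrow> bool" where
  "smooth_on S f \<longleftrightarrow> (\<forall>k. C_k_on k S f)"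

type_synonym ('p, 'k) chart = "'p set \<times> ('p \<Rightarrow> real^'k)"

definition coord_image :: "('p, 'k) chart \<Rightarrow> (real^'k) set" where
  "coord_image c = snd c ` fst c"

definition overlap :: "('p, 'k) chart \<Rightarrow> ('p, 'k) chart \<Rightarrow> (real^'k) set" where
  "overlap c d = snd c ` (fst c \<inter> fst d)"

definition transition :: "('p, 'k) chart \<Rightarrow> ('p, 'k) chart \<Rightarrow> real^'k \<Rightarrow> real^'k" where
  "transition c d = snd d \<circ> inv_into (fst c) (snd c)"

definition dtransition ::
    "('p, 'k::finite) chart \<Rightarrow> ('p, 'k) chart \<Rightarrow> real^'k \<Rightarrow> real^'k \<Rightarrow> real^'k" where
  "dtransition c d x = frechet_derivative (transition c d) (at x)"

definition smooth_manifold :: "'p topology \<Rightarrow> ('p, 'k::finite) chart set \<Rightarrow> bool" where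
  "smooth_manifold M A \<longleftrightarrow>
     Hausdorff_space M \<and> second_countable M \<and> topspace M = \<Union>(fst ` A) \<and>
     (\<forall>c\<in>A. openin M (fst c) \<and> open (coord_image c) \<and>
        homeomorphic_map (subtopology M (fst c)) (top_of_set (coord_image c)) (snd c)) \<and>
     (\<forall>c\<in>A. \<forall>d\<in>A. smooth_on (overlap c d) (transition c d))"


section \<open>Objects on the tangent bundle, given by their components in the charts\<close>

text \<open>
  A point of the tangent bundle over the domain of a chart \<open>c\<close> is a pair \<open>(x, y)\<close> of coordinate
  vectors.  A function, a set or a covector field on (a part of) the tangent bundle is the family of
  its coordinate representations indexed by the charts, subject to the transformation law under
  \<open>(x, y) \<mapsto> (transition c d x, dtransition c d x y)\<close>.
\<close>

type_synonym 'k scalar = "real^'k \<Rightarrow> real^'k \<Rightarrow> real"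

text \<open>
  The set \<open>D\<close> of admissible supporting elements.  The classical choice is the whole slit tangent
  bundle \<open>y \<noteq> 0\<close>, which is an instance (lemma \<open>conic_domain_slit\<close> below).  More generally, any open
  conic part of it is allowed, as is customary for metrics such as Matsumoto's.  This generality
  matters: in dimension at least 3, no field that is smooth on the whole slit tangent bundle is an
  \<open>h\<close>-vector, because the trace \<open>L C\<^sup>h b\<^sub>h = (n - 1) \<rho>\<close> vanishes where \<open>det g\<close>, which is
  homogeneous of degree 0 in \<open>y\<close>, is extremal, and \<open>\<rho>\<close> does not depend on \<open>y\<close>.
\<close>

definition conic_domain ::
    "('p, 'k::finite) chart set \<Rightarrow> (('p, 'k) chart \<Rightarrow> ((real^'k) \<times> (real^'k)) set) \<Rightarrow> bool" where
  "conic_domain A D \<longleftrightarrow>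
     (\<forall>c\<in>A. open (D c) \<and> D c \<subseteq> coord_image c \<times> {y. y \<noteq> 0} \<and>
        (\<forall>x\<in>coord_image c. \<exists>y. (x, y) \<in> D c) \<and>
        (\<forall>x y t. (x, y) \<in> D c \<and> t > 0 \<longrightarrow> (x, t *\<^sub>R y) \<in> D c)) \<and>
     (\<forall>c\<in>A. \<forall>d\<in>A. \<forall>x\<in>overlap c d. \<forall>y.
        (x, y) \<in> D c \<longleftrightarrow> (transition c d x, dtransition c d x y) \<in> D d)"

definition scalar_field ::
    "('p, 'k::finite) chart set \<Rightarrow> (('p, 'k) chart \<Rightarrow> ((real^'k) \<times> (real^'k)) set) \<Rightarrow>
     (('p, 'k) chart \<Rightarrow> 'k scalar) \<Rightarrow> bool" where
  "scalar_field A D f \<longleftrightarrow>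
     (\<forall>c\<in>A. \<forall>d\<in>A. \<forall>x\<in>overlap c d. \<forall>y. (x, y) \<in> D c \<longrightarrow>
        f c x y = f d (transition c d x) (dtransition c d x y))"

definition covector_field ::
    "('p, 'k::finite) chart set \<Rightarrow> (('p, 'k) chart \<Rightarrow> ((real^'k) \<times> (real^'k)) set) \<Rightarrow>
     (('p, 'k) chart \<Rightarrow> 'k \<Rightarrow> 'k scalar) \<Rightarrow> bool" where
  "covector_field A D b \<longleftrightarrow>
     (\<forall>c\<in>A. \<forall>i. smooth_on (D c) (\<lambda>(x, y). b c i x y)) \<and>
     (\<forall>c\<in>A. \<forall>d\<in>A. \<forall>x\<in>overlap c d. \<forall>y. (x, y) \<in> D c \<longrightarrow>
        (\<forall>i. b c i x y = (\<Sum>j\<in>UNIV.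
           b d j (transition c d x) (dtransition c d x y) * dtransition c d x (axis i 1) $ j)))"


section \<open>Finsler tensors and the Cartan connection in a chart\<close>

definition pd :: "'k::finite \<Rightarrow> (real^'k \<Rightarrow> real) \<Rightarrow> real^'k \<Rightarrow> real" where
  "pd i f x = deriv (\<lambda>t. f (x + t *\<^sub>R axis i 1)) 0"

definition pdx :: "'k::finite \<Rightarrow> 'k scalar \<Rightarrow> 'k scalar" where
  "pdx i f = (\<lambda>x y. pd i (\<lambda>z. f z y) x)"

definition pdy :: "'k::finite \<Rightarrow> 'k scalar \<Rightarrow> 'k scalar" where
  "pdy i f = (\<lambda>x y. pd i (f x) y)"

definition metric_g :: "'k::finite scalar \<Rightarrow> 'k \<Rightarrow> 'k \<Rightarrow> 'k scalar" where
  "metric_g L i j = (\<lambda>x y. 1/2 * pdy i (pdy j (\<lambda>x y. (L x y)\<^sup>2)) x y)"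

definition metric_inv :: "'k::finite scalar \<Rightarrow> 'k \<Rightarrow> 'k \<Rightarrow> 'k scalar" where
  "metric_inv L i j = (\<lambda>x y. matrix_inv (\<chi> i j. metric_g L i j x y) $ i $ j)"

definition angular_metric :: "'k::finite scalar \<Rightarrow> 'k \<Rightarrow> 'k \<Rightarrow> 'k scalar" where
  "angular_metric L i j = (\<lambda>x y. L x y * pdy i (pdy j L) x y)"

definition cartan_tensor :: "'k::finite scalar \<Rightarrow> 'k \<Rightarrow> 'k \<Rightarrow> 'k \<Rightarrow> 'k scalar" where
  "cartan_tensor L i j k = (\<lambda>x y. 1/2 * pdy k (metric_g L i j) x y)"

text \<open>\<open>cartan_C L h i j\<close> is \<open>C\<^sup>h\<^sub>i\<^sub>j\<close>: the upper index comes first.  The same holds for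
  \<open>spray_conn L i j\<close> and \<open>cartan_F L i j k\<close>, that is, \<open>G\<^sup>i\<^sub>j\<close> and \<open>F\<^sup>i\<^sub>j\<^sub>k\<close>.\<close>

definition cartan_C :: "'k::finite scalar \<Rightarrow> 'k \<Rightarrow> 'k \<Rightarrow> 'k \<Rightarrow> 'k scalar" where
  "cartan_C L h i j = (\<lambda>x y. \<Sum>k\<in>UNIV. metric_inv L h k x y * cartan_tensor L i j k x y)"

definition spray :: "'k::finite scalar \<Rightarrow> 'k \<Rightarrow> 'k scalar" where
  "spray L i = (\<lambda>x y. 1/4 * (\<Sum>j\<in>UNIV. metric_inv L i j x y *
     ((\<Sum>r\<in>UNIV. y $ r * pdy j (pdx r (\<lambda>x y. (L x y)\<^sup>2)) x y) - pdx j (\<lambda>x y. (L x y)\<^sup>2) x y)))"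

definition spray_conn :: "'k::finite scalar \<Rightarrow> 'k \<Rightarrow> 'k \<Rightarrow> 'k scalar" where
  "spray_conn L i j = pdy j (spray L i)"

definition delta :: "'k::finite scalar \<Rightarrow> 'k \<Rightarrow> 'k scalar \<Rightarrow> 'k scalar" where
  "delta L j f = (\<lambda>x y. pdx j f x y - (\<Sum>r\<in>UNIV. spray_conn L r j x y * pdy r f x y))"

definition cartan_F :: "'k::finite scalar \<Rightarrow> 'k \<Rightarrow> 'k \<Rightarrow> 'k \<Rightarrow> 'k scalar" where
  "cartan_F L i j k = (\<lambda>x y. 1/2 * (\<Sum>h\<in>UNIV. metric_inv L i h x y *
     (delta L j (metric_g L h k) x y + delta L k (metric_g L h j) x y - delta L h (metric_g L j k) x y)))"

text \<open>\<open>hcov L b i j\<close> is \<open>b\<^sub>i\<^sub>|\<^sub>j\<close>, and \<open>vcov L b i j\<close> is its vertical counterpart.\<close>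

definition hcov :: "'k::finite scalar \<Rightarrow> ('k \<Rightarrow> 'k scalar) \<Rightarrow> 'k \<Rightarrow> 'k \<Rightarrow> 'k scalar" where
  "hcov L b i j = (\<lambda>x y. delta L j (b i) x y - (\<Sum>r\<in>UNIV. b r x y * cartan_F L r i j x y))"

definition vcov :: "'k::finite scalar \<Rightarrow> ('k \<Rightarrow> 'k scalar) \<Rightarrow> 'k \<Rightarrow> 'k \<Rightarrow> 'k scalar" where
  "vcov L b i j = (\<lambda>x y. pdy j (b i) x y - (\<Sum>r\<in>UNIV. b r x y * cartan_C L r i j x y))"


section \<open>Finsler spaces, h-vectors and the h-Matsumoto change\<close>

definition fundamental_function ::
    "('p, 'k::finite) chart set \<Rightarrow> (('p, 'k) chart \<Rightarrow> ((real^'k) \<times> (real^'k)) set) \<Rightarrow>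
     (('p, 'k) chart \<Rightarrow> 'k scalar) \<Rightarrow> bool" where
  "fundamental_function A D L \<longleftrightarrow> scalar_field A D L \<and>
     (\<forall>c\<in>A. smooth_on (D c) (\<lambda>(x, y). L c x y) \<and>
        (\<forall>x y. (x, y) \<in> D c \<longrightarrow>
           L c x y > 0 \<and>
           (\<forall>t>0. L c x (t *\<^sub>R y) = t * L c x y) \<and>
           (\<forall>w. w \<noteq> 0 \<longrightarrow> (\<Sum>i\<in>UNIV. \<Sum>j\<in>UNIV. metric_g (L c) i j x y * w $ i * w $ j) > 0)))"

definition finsler_space ::
    "'p topology \<Rightarrow> ('p, 'k::finite) chart set \<Rightarrow> (('p, 'k) chart \<Rightarrow> ((real^'k) \<times> (real^'k)) set) \<Rightarrow>
     (('p, 'k) chart \<Rightarrow> 'k scalar) \<Rightarrow> bool" where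
  "finsler_space M A D L \<longleftrightarrow>
     smooth_manifold M A \<and> conic_domain A D \<and> fundamental_function A D L"

text \<open>``Non-zero'' is read as ``not the zero function''; this covers a nowhere vanishing \<open>\<rho>\<close>
  (on a nonempty manifold).\<close>

definition h_vector ::
    "('p, 'k::finite) chart set \<Rightarrow> (('p, 'k) chart \<Rightarrow> ((real^'k) \<times> (real^'k)) set) \<Rightarrow>
     (('p, 'k) chart \<Rightarrow> 'k scalar) \<Rightarrow> (('p, 'k) chart \<Rightarrow> 'k \<Rightarrow> 'k scalar) \<Rightarrow> bool" where
  "h_vector A D L b \<longleftrightarrow> covector_field A D b \<and>
     (\<forall>c\<in>A. \<forall>x y. (x, y) \<in> D c \<longrightarrow> (\<forall>i k. vcov (L c) (b c) i k x y = 0)) \<and>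
     (\<exists>\<rho>. scalar_field A D \<rho> \<and> (\<exists>c\<in>A. \<exists>x y. (x, y) \<in> D c \<and> \<rho> c x y \<noteq> 0) \<and>
        (\<forall>c\<in>A. \<forall>x y. (x, y) \<in> D c \<longrightarrow> (\<forall>i j.
           L c x y * (\<Sum>h\<in>UNIV. cartan_C (L c) h i j x y * b c h x y)
             = \<rho> c x y * angular_metric (L c) i j x y)))"

definition parallel ::
    "('p, 'k::finite) chart set \<Rightarrow> (('p, 'k) chart \<Rightarrow> ((real^'k) \<times> (real^'k)) set) \<Rightarrow>
     (('p, 'k) chart \<Rightarrow> 'k scalar) \<Rightarrow> (('p, 'k) chart \<Rightarrow> 'k \<Rightarrow> 'k scalar) \<Rightarrow> bool" where
  "parallel A D L b \<longleftrightarrow>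
     (\<forall>c\<in>A. \<forall>x y. (x, y) \<in> D c \<longrightarrow> (\<forall>i j. hcov (L c) (b c) i j x y = 0))"

definition beta ::
    "(('p, 'k::finite) chart \<Rightarrow> 'k \<Rightarrow> 'k scalar) \<Rightarrow> ('p, 'k) chart \<Rightarrow> 'k scalar" where
  "beta b c x y = (\<Sum>i\<in>UNIV. b c i x y * y $ i)"

definition h_matsumoto ::
    "(('p, 'k::finite) chart \<Rightarrow> 'k scalar) \<Rightarrow> (('p, 'k) chart \<Rightarrow> 'k \<Rightarrow> 'k scalar) \<Rightarrow>
     ('p, 'k) chart \<Rightarrow> 'k scalar" where
  "h_matsumoto L b c x y = (L c x y)\<^sup>2 / (L c x y - beta b c x y)"


section \<open>Hypersurfaces: the parametric equations \<open>x = X u\<close> in charts\<close>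

text \<open>\<open>proj X i \<alpha> u\<close> is \<open>B\<^sup>i\<^sub>\<alpha>\<close>, and \<open>proj2 X i \<alpha> \<beta> u\<close> is \<open>B\<^sup>i\<^sub>\<alpha>\<^sub>\<beta>\<close>.\<close>

definition proj :: "(real^'m::finite \<Rightarrow> real^'n) \<Rightarrow> 'n \<Rightarrow> 'm \<Rightarrow> real^'m \<Rightarrow> real" where
  "proj X i \<alpha> u = pd \<alpha> (\<lambda>u. X u $ i) u"

definition proj2 :: "(real^'m::finite \<Rightarrow> real^'n) \<Rightarrow> 'n \<Rightarrow> 'm \<Rightarrow> 'm \<Rightarrow> real^'m \<Rightarrow> real" where
  "proj2 X i \<alpha> \<beta> u = pd \<alpha> (pd \<beta> (\<lambda>u. X u $ i)) u"

definition supp_elt :: "(real^'m::finite \<Rightarrow> real^'n::finite) \<Rightarrow> real^'m \<Rightarrow> real^'m \<Rightarrow> real^'n" where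
  "supp_elt X u v = (\<chi> i. \<Sum>\<alpha>\<in>UNIV. proj X i \<alpha> u * v $ \<alpha>)"

text \<open>The unit normal is determined only up to its sign; \<open>H\<^sub>\<alpha>\<^sub>\<beta>\<close> and \<open>M\<^sub>\<alpha>\<^sub>\<beta>\<close> merely change sign with
  it.  It therefore appears as an explicit argument \<open>B\<close> below, and conditions involving it are
  imposed for both choices.\<close>

definition unit_normal ::
    "'n::finite scalar \<Rightarrow> (real^'m::finite \<Rightarrow> real^'n) \<Rightarrow> real^'m \<Rightarrow> real^'m \<Rightarrow> real^'n \<Rightarrow> bool" where
  "unit_normal L X u v B \<longleftrightarrow>
     (\<forall>\<alpha>. (\<Sum>i\<in>UNIV. \<Sum>j\<in>UNIV. metric_g L i j (X u) (supp_elt X u v) * proj X i \<alpha> u * B $ j) = 0) \<and>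
     (\<Sum>i\<in>UNIV. \<Sum>j\<in>UNIV. metric_g L i j (X u) (supp_elt X u v) * B $ i * B $ j) = 1"

definition normal_low ::
    "'n::finite scalar \<Rightarrow> (real^'m::finite \<Rightarrow> real^'n) \<Rightarrow> real^'m \<Rightarrow> real^'m \<Rightarrow> real^'n \<Rightarrow> 'n \<Rightarrow> real"
  where
  "normal_low L X u v B i = (\<Sum>j\<in>UNIV. metric_g L i j (X u) (supp_elt X u v) * B $ j)"

definition H1 ::
    "'n::finite scalar \<Rightarrow> (real^'m::finite \<Rightarrow> real^'n) \<Rightarrow> real^'m \<Rightarrow> real^'m \<Rightarrow> real^'n \<Rightarrow> 'm \<Rightarrow> real"
  where
  "H1 L X u v B \<alpha> = (\<Sum>i\<in>UNIV. normal_low L X u v B i *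
     ((\<Sum>\<beta>\<in>UNIV. proj2 X i \<beta> \<alpha> u * v $ \<beta>) +
      (\<Sum>j\<in>UNIV. spray_conn L i j (X u) (supp_elt X u v) * proj X j \<alpha> u)))"

definition M1 ::
    "'n::finite scalar \<Rightarrow> (real^'m::finite \<Rightarrow> real^'n) \<Rightarrow> real^'m \<Rightarrow> real^'m \<Rightarrow> real^'n \<Rightarrow> 'm \<Rightarrow> real"
  where
  "M1 L X u v B \<alpha> = (\<Sum>i\<in>UNIV. \<Sum>j\<in>UNIV. \<Sum>k\<in>UNIV.
     cartan_tensor L i j k (X u) (supp_elt X u v) * proj X i \<alpha> u * B $ j * B $ k)"

definition M2 ::
    "'n::finite scalar \<Rightarrow> (real^'m::finite \<Rightarrow> real^'n) \<Rightarrow> real^'m \<Rightarrow> real^'m \<Rightarrow> real^'n \<Rightarrow>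
     'm \<Rightarrow> 'm \<Rightarrow> real" where
  "M2 L X u v B \<alpha> \<beta> = (\<Sum>i\<in>UNIV. \<Sum>j\<in>UNIV. \<Sum>k\<in>UNIV.
     cartan_tensor L i j k (X u) (supp_elt X u v) * B $ i * proj X j \<alpha> u * proj X k \<beta> u)"

definition H2 ::
    "'n::finite scalar \<Rightarrow> (real^'m::finite \<Rightarrow> real^'n) \<Rightarrow> real^'m \<Rightarrow> real^'m \<Rightarrow> real^'n \<Rightarrow>
     'm \<Rightarrow> 'm \<Rightarrow> real" where
  "H2 L X u v B \<alpha> \<beta> = (\<Sum>i\<in>UNIV. normal_low L X u v B i *
     (proj2 X i \<alpha> \<beta> u +
      (\<Sum>j\<in>UNIV. \<Sum>k\<in>UNIV.
         cartan_F L i j k (X u) (supp_elt X u v) * proj X j \<alpha> u * proj X k \<beta> u)))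
     + M1 L X u v B \<alpha> * H1 L X u v B \<beta>"

definition param_dom ::
    "('q \<Rightarrow> 'p) \<Rightarrow> ('p, 'n) chart \<Rightarrow> ('q, 'm) chart \<Rightarrow> (real^'m) set" where
  "param_dom f c e = snd e ` {q \<in> fst e. f q \<in> fst c}"

definition param ::
    "('q \<Rightarrow> 'p) \<Rightarrow> ('p, 'n) chart \<Rightarrow> ('q, 'm) chart \<Rightarrow> real^'m \<Rightarrow> real^'n" where
  "param f c e = snd c \<circ> f \<circ> inv_into (fst e) (snd e)"

text \<open>The hypersurface is an \<open>(n - 1)\<close>-dimensional manifold \<open>N\<close> with atlas \<open>E\<close>, immersed by \<open>f\<close>.
  A single parametrised piece \<open>x = X u\<close> is the case where \<open>N\<close> is an open set of parameters.\<close>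

definition hypersurface ::
    "'p topology \<Rightarrow> ('p, 'n::finite) chart set \<Rightarrow>
     'q topology \<Rightarrow> ('q, 'm::finite) chart set \<Rightarrow> ('q \<Rightarrow> 'p) \<Rightarrow> bool" where
  "hypersurface M A N E f \<longleftrightarrow>
     smooth_manifold N E \<and> CARD('n) = CARD('m) + 1 \<and> continuous_map N M f \<and>
     (\<forall>c\<in>A. \<forall>e\<in>E. smooth_on (param_dom f c e) (param f c e) \<and>
        (\<forall>u\<in>param_dom f c e.
           rank (\<chi> i \<alpha>. proj (param f c e) i \<alpha> u :: real^'m^'n) = CARD('m)))"

text \<open>As \<open>D c\<close> contains no pair \<open>(x, 0)\<close>, these are pairs with \<open>v \<noteq> 0\<close>.\<close>

definition supporting ::
    "(('p, 'n::finite) chart \<Rightarrow> ((real^'n) \<times> (real^'n)) set) \<Rightarrow> ('q \<Rightarrow> 'p) \<Rightarrow>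
     ('p, 'n) chart \<Rightarrow> ('q, 'm::finite) chart \<Rightarrow> ((real^'m) \<times> (real^'m)) set" where
  "supporting D f c e = {(u, v). u \<in> param_dom f c e \<and>
     (param f c e u, supp_elt (param f c e) u v) \<in> D c}"

definition tangent_to ::
    "('p, 'n::finite) chart set \<Rightarrow> (('p, 'n) chart \<Rightarrow> ((real^'n) \<times> (real^'n)) set) \<Rightarrow>
     (('p, 'n) chart \<Rightarrow> 'n scalar) \<Rightarrow> (('p, 'n) chart \<Rightarrow> 'n \<Rightarrow> 'n scalar) \<Rightarrow>
     ('q, 'm::finite) chart set \<Rightarrow> ('q \<Rightarrow> 'p) \<Rightarrow> bool" where
  "tangent_to A D L b E f \<longleftrightarrow>
     (\<forall>c\<in>A. \<forall>e\<in>E. \<forall>(u, v)\<in>supporting D f c e. \<forall>B. unit_normal (L c) (param f c e) u v B \<longrightarrow>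
        (\<Sum>i\<in>UNIV. b c i (param f c e u) (supp_elt (param f c e) u v) * B $ i) = 0)"

definition hyperplane_second_kind ::
    "('p, 'n::finite) chart set \<Rightarrow> (('p, 'n) chart \<Rightarrow> ((real^'n) \<times> (real^'n)) set) \<Rightarrow>
     (('p, 'n) chart \<Rightarrow> 'n scalar) \<Rightarrow> ('q, 'm::finite) chart set \<Rightarrow> ('q \<Rightarrow> 'p) \<Rightarrow> bool" where
  "hyperplane_second_kind A D L E f \<longleftrightarrow>
     (\<forall>c\<in>A. \<forall>e\<in>E. \<forall>(u, v)\<in>supporting D f c e. \<forall>B. unit_normal (L c) (param f c e) u v B \<longrightarrow>
        (\<forall>\<alpha> \<beta>. H2 (L c) (param f c e) u v B \<alpha> \<beta> = 0))"

definition hyperplane_third_kind ::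
    "('p, 'n::finite) chart set \<Rightarrow> (('p, 'n) chart \<Rightarrow> ((real^'n) \<times> (real^'n)) set) \<Rightarrow>
     (('p, 'n) chart \<Rightarrow> 'n scalar) \<Rightarrow> ('q, 'm::finite) chart set \<Rightarrow> ('q \<Rightarrow> 'p) \<Rightarrow> bool" where
  "hyperplane_third_kind A D L E f \<longleftrightarrow>
     (\<forall>c\<in>A. \<forall>e\<in>E. \<forall>(u, v)\<in>supporting D f c e. \<forall>B. unit_normal (L c) (param f c e) u v B \<longrightarrow>
        (\<forall>\<alpha> \<beta>. H2 (L c) (param f c e) u v B \<alpha> \<beta> = 0 \<and> M2 (L c) (param f c e) u v B \<alpha> \<beta> = 0))"


section \<open>Sanity checks\<close>

lemma dtransition_inverse:
  assumes "smooth_manifold M A" "c \<in> A" "d \<in> A" "x \<in> overlap c d"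
  shows "transition c d x \<in> overlap d c" and "dtransition d c (transition c d x) (dtransition c d x y) = y"
proof -
  have inj: "inj_on (snd c) (fst c)" if "c \<in> A" for c
  proof -
    have "homeomorphic_map (subtopology M (fst c)) (top_of_set (coord_image c)) (snd c)"
      and "openin M (fst c)" using assms(1) that by (auto simp: smooth_manifold_def)
    then show ?thesis
      by (metis homeomorphic_map_def openin_subset topspace_subtopology_subset)
  qed
  have tr: "transition c d z \<in> overlap d c \<and> transition d c (transition c d z) = z"
    if "z \<in> overlap c d" for z
    using that inj[OF assms(2)] inj[OF assms(3)] by (auto simp: overlap_def transition_def)
  show 1: "transition c d x \<in> overlap d c" using tr assms(4) by blast
  have op: "open (overlap c d)"
  proof -
    have hc: "homeomorphic_map (subtopology M (fst c)) (top_of_set (coord_image c)) (snd c)"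
      and o: "openin M (fst c)" "openin M (fst d)" "open (coord_image c)"
      using assms by (auto simp: smooth_manifold_def)
    have "openin (subtopology M (fst c)) (fst c \<inter> fst d)"
      using o by (simp add: openin_subtopology_Int2)
    then have "openin (top_of_set (coord_image c)) (overlap c d)"
      using hc unfolding overlap_def
      by (metis homeomorphic_map_openness_eq)
    then show ?thesis using o(3) openin_open_trans by blast
  qed
  have df: "transition c d differentiable at z" if "z \<in> overlap c d" "c \<in> A" "d \<in> A" for c d z
  proof -
    have "C_k_on (Suc 0) (overlap c d) (transition c d)"
      using assms(1) that unfolding smooth_manifold_def smooth_on_def by blast
    then show ?thesis using that by simp
  qed
  have "(transition d c \<circ> transition c d has_derivative
      dtransition d c (transition c d x) \<circ> dtransition c d x) (at x)"
    unfolding dtransition_def using df[OF assms(4,2,3)] df[OF 1 assms(3,2)]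
    by (intro diff_chain_at) (auto simp: frechet_derivative_works)
  moreover have "(transition d c \<circ> transition c d has_derivative (\<lambda>h. h)) (at x)"
    by (rule has_derivative_transform_within_open[OF has_derivative_ident op assms(4)])
      (use tr in auto)
  ultimately have "dtransition d c (transition c d x) \<circ> dtransition c d x = (\<lambda>h. h)"
    using has_derivative_unique by blast
  then show "dtransition d c (transition c d x) (dtransition c d x y) = y"
    by (metis comp_apply)
qed

lemma conic_domain_slit:
  assumes "smooth_manifold M A"
  shows "conic_domain A (\<lambda>c. coord_image c \<times> {y. y \<noteq> 0})"
proof -
  have nz: "\<exists>y::real^'k. y \<noteq> 0"
    by (metis axis_eq_0_iff zero_neq_one)
  have "linear (dtransition c d x)" if "c \<in> A" "d \<in> A" "x \<in> overlap c d" for c d x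
  proof -
    have "C_k_on (Suc 0) (overlap c d) (transition c d)"
      using assms that unfolding smooth_manifold_def smooth_on_def by blast
    then show ?thesis using that by (simp add: dtransition_def linear_frechet_derivative)
  qed
  then have z: "dtransition c d x y = 0 \<longleftrightarrow> y = 0"
    if "c \<in> A" "d \<in> A" "x \<in> overlap c d" for c d x y
    using that dtransition_inverse[OF assms that] linear_0
    by (metis dtransition_inverse(1)[OF assms])
  have "open {y::real^'k. y \<noteq> 0}"
    by (simp add: open_Collect_neq)
  moreover have "transition c d x \<in> coord_image d" "x \<in> coord_image c"
    if "c \<in> A" "d \<in> A" "x \<in> overlap c d" for c d x
    using dtransition_inverse(1)[OF assms that] that by (auto simp: overlap_def coord_image_def)
  ultimately show ?thesis
    using assms nz z by (auto simp: conic_domain_def smooth_manifold_def intro!: open_Times)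
qed

lemma unit_normal_exists:
  fixes X :: "real^'m::finite \<Rightarrow> real^'n::finite"
  assumes "CARD('n) = CARD('m) + 1"
    and pos: "\<And>w. w \<noteq> 0 \<Longrightarrow>
      (\<Sum>i\<in>UNIV. \<Sum>j\<in>UNIV. metric_g L i j (X u) (supp_elt X u v) * w $ i * w $ j) > 0"
  shows "\<exists>B. unit_normal L X u v B"
proof -
  let ?g = "\<lambda>i j. metric_g L i j (X u) (supp_elt X u v)"
  let ?S = "range (\<lambda>\<alpha>. (\<chi> j. \<Sum>i\<in>UNIV. ?g i j * proj X i \<alpha> u) :: real^'n)"
  have "dim ?S \<le> card ?S" by (rule dim_le_card') simp
  also have "\<dots> \<le> CARD('m)" by (rule card_image_le) simp
  finally have "dim ?S < DIM(real^'n)" using assms(1) by simp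
  then obtain w where w: "w \<noteq> 0" "\<And>s. s \<in> span ?S \<Longrightarrow> orthogonal w s"
    by (rule orthogonal_to_subspace_exists) auto
  have perp: "(\<Sum>i\<in>UNIV. \<Sum>j\<in>UNIV. ?g i j * proj X i \<alpha> u * w $ j) = 0" for \<alpha>
  proof -
    have "orthogonal w (\<chi> j. \<Sum>i\<in>UNIV. ?g i j * proj X i \<alpha> u)"
      using w(2) by (simp add: span_base)
    then show ?thesis
      by (subst sum.swap) (simp add: orthogonal_def inner_vec_def sum_distrib_left mult_ac)
  qed
  define q where "q = (\<Sum>i\<in>UNIV. \<Sum>j\<in>UNIV. ?g i j * w $ i * w $ j)"
  have "q > 0" unfolding q_def using pos w(1) by blast
  define r where "r = 1 / sqrt q"
  define B where "B = r *\<^sub>R w"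
  have "(\<Sum>i\<in>UNIV. \<Sum>j\<in>UNIV. ?g i j * B $ i * B $ j) = r\<^sup>2 * q"
    unfolding q_def sum_distrib_left by (simp add: B_def power2_eq_square mult_ac)
  also have "\<dots> = 1" using \<open>q > 0\<close> by (simp add: r_def power_divide)
  finally have 1: "(\<Sum>i\<in>UNIV. \<Sum>j\<in>UNIV. ?g i j * B $ i * B $ j) = 1" .
  have "(\<Sum>i\<in>UNIV. \<Sum>j\<in>UNIV. ?g i j * proj X i \<alpha> u * B $ j)
      = r * (\<Sum>i\<in>UNIV. \<Sum>j\<in>UNIV. ?g i j * proj X i \<alpha> u * w $ j)" for \<alpha>
    unfolding sum_distrib_left by (simp add: B_def mult_ac)
  then show ?thesis using 1 perp by (auto simp: unit_normal_def)
qed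

end

theory Submission
  imports Defs
begin

text \<open>
  All objects of the theorem live in one chart, and the conditions on the hypersurface are conditions
  at one supporting element \<open>(x, y)\<close>.  Write \<open>Q = L\<^sup>2\<close>, let \<open>Qb\<close> be the square of the changed function,
  \<open>G\<^sup>i\<close> the spray of \<open>L\<close>, and let an index on a function stand for a derivative with respect to \<open>y\<close>.

  \<^emph>\<open>The spray does not change.\<close>  For an \<open>h\<close>-vector, \<open>b\<^sub>i\<close> has the \<open>y\<close>-derivatives \<open>\<rho> L\<^sub>i\<^sub>j\<close>; hence
  \<open>b\<^sub>i = \<beta>\<^sub>i\<close>, and the Hessian of \<open>\<beta>\<close> is \<open>\<rho>\<close> times that of \<open>L\<close>.  Since \<open>b\<close> is parallel, \<open>\<delta>\<^sub>j \<beta> = 0\<close>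
  (\<open>horizontally_constant_beta\<close>), and \<open>\<delta>\<^sub>j L = 0\<close> holds in every Finsler space.  The changed function
  is a function of \<open>L\<close> and \<open>\<beta>\<close>, so \<open>\<delta>\<^sub>j\<close> annihilates it as well; as only the spray has this property
  among the functions of degree 2 (\<open>spray_unique\<close>), both spaces have the same \<open>G\<^sup>i\<close> (\<open>bar_spray\<close>).

  \<^emph>\<open>Derivatives in the normal direction are proportional.\<close>  On the normal \<open>B\<close> of a hypersurface both
  \<open>L\<^sub>i\<close> and, by tangency, \<open>\<beta>\<^sub>i = b\<^sub>i\<close> vanish.  The gradient of \<open>Qb\<close> is \<open>p L\<^sub>i + s \<beta>\<^sub>i\<close>.  Differentiate it
  and contract with \<open>B\<close> once and with tangent vectors otherwise: every term in which \<open>p\<close> or \<open>s\<close> is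
  differentiated contains \<open>L\<^sub>B\<close>, \<open>\<beta>\<^sub>B\<close> or a Hessian entry of \<open>L\<close> with one normal and one tangent argument,
  and drops out.  What remains is \<open>p + s \<rho>\<close> times the derivative of \<open>L\<close>.  The same holds for \<open>Q\<close>, with
  \<open>p = 2 L\<close> and \<open>s = 0\<close>.  So all these contractions of \<open>Qb\<close> are those of \<open>Q\<close> times one number
  \<open>\<tau> = (p + s \<rho>) / (2 L)\<close> (\<open>bar_normal\<close>), which is positive because both metrics are.  Second order:
  the two normals are proportional.  Third order: the tensors \<open>M\<^sub>\<alpha>\<^sub>\<beta>\<close> are proportional.

  \<^emph>\<open>The Cartan connection.\<close>  Differentiating \<open>\<delta>\<^sub>j Q = 0\<close> twice expresses \<open>\<delta>\<^sub>j g\<^sub>h\<^sub>k\<close> by derivatives of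
  \<open>G\<close> and \<open>Q\<close>, and yields \<open>g\<^sub>m\<^sub>i F\<^sup>i\<^sub>j\<^sub>k = g\<^sub>m\<^sub>i G\<^sup>i\<^sub>j\<^sub>k + Q\<^sub>r G\<^sup>r\<^sub>m\<^sub>j\<^sub>k / 4\<close> (\<open>cartan_F_lowered\<close>).  Since \<open>G\<close> is common
  to the two spaces, comparing the normal parts of \<open>F\<close> amounts to comparing \<open>Q\<^sub>r G\<^sup>r\<^sub>B\<^sub>\<alpha>\<^sub>\<beta>\<close>.  This follows
  in the same way from \<open>\<delta>\<^sub>j L = 0\<close> and \<open>\<delta>\<^sub>j \<beta> = 0\<close>, differentiated twice (\<open>normal_connection_term\<close>).

  \<^emph>\<open>Second fundamental form.\<close>  The product \<open>M\<^sub>\<alpha> H\<^sub>\<beta>\<close> in \<open>H\<^sub>\<alpha>\<^sub>\<beta>\<close> does not scale by \<open>\<tau>\<close>.  But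
  \<open>M\<^sub>\<alpha> v\<^sup>\<alpha> = 0\<close>, and the remaining part of \<open>H\<^sub>\<alpha>\<^sub>\<beta>\<close> contracted with \<open>v\<^sup>\<alpha>\<close> is \<open>H\<^sub>\<beta>\<close>.  Hence \<open>H\<^sub>\<alpha>\<^sub>\<beta> = 0\<close> if and
  only if \<open>H\<^sub>\<beta>\<close> and this remaining part vanish (\<open>H2_vanishes_iff\<close>), and each of these two is linear in
  \<open>B\<close> and is multiplied by \<open>\<tau>\<close>.
\<close>

section \<open>Functions of class \<open>C\<^sup>k\<close> and the symmetry of second derivatives\<close>

lemma has_derivative_frechetD:
  assumes "(f has_derivative f') (at x)"
  shows "f differentiable at x" and "frechet_derivative f (at x) v = f' v"
  using assms frechet_derivative_at[OF assms] by (auto simp: differentiable_def)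

lemma C_k_on_SucI:
  assumes "\<And>x. x \<in> S \<Longrightarrow> f differentiable (at x)"
    and "\<And>v. C_k_on k S (\<lambda>x. frechet_derivative f (at x) v)"
  shows "C_k_on (Suc k) S f"
  using assms by simp

lemma C_k_on_cong:
  assumes "open S"
  shows "C_k_on k S f \<Longrightarrow> (\<And>x. x \<in> S \<Longrightarrow> f x = g x) \<Longrightarrow> C_k_on k S g"
proof (induction k arbitrary: f g)
  case 0
  then show ?case using continuous_on_cong[of S S f g] by simp
next
  case (Suc k)
  have d: "g differentiable at x" "frechet_derivative f (at x) = frechet_derivative g (at x)"
    if "x \<in> S" for x
  proof -
    have f: "f differentiable at x" using Suc.prems(1) that by simp
    then show "frechet_derivative f (at x) = frechet_derivative g (at x)"
      using frechet_derivative_transform_within_open[OF f assms that] Suc.prems(2) by blast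
    have "(f has_derivative frechet_derivative f (at x)) (at x)"
      using f by (simp add: frechet_derivative_works)
    then have "(g has_derivative frechet_derivative f (at x)) (at x)"
      by (rule has_derivative_transform_within_open[OF _ assms that]) (use Suc.prems(2) in auto)
    then show "g differentiable at x" by (auto simp: differentiable_def)
  qed
  have "C_k_on k S (\<lambda>x. frechet_derivative g (at x) v)" for v
    by (rule Suc.IH[of "\<lambda>x. frechet_derivative f (at x) v"]) (use Suc.prems(1) d in auto)
  then show ?case using d by simp
qed

lemma C_k_on_SucD: "C_k_on (Suc k) S f \<Longrightarrow> C_k_on k S f"
proof (induction k arbitrary: f)
  case 0
  then show ?case
    by (simp add: continuous_at_imp_continuous_on differentiable_imp_continuous_within)
next
  case (Suc k)
  have "C_k_on k S (\<lambda>x. frechet_derivative f (at x) v)" for v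
    by (rule Suc.IH) (use Suc.prems in simp)
  then show ?case using Suc.prems by simp
qed

lemma C_k_on_const: "C_k_on k S (\<lambda>x. c)"
  by (induction k arbitrary: c) auto

lemma C_k_on_bounded_linear:
  assumes "bounded_linear h"
  shows "C_k_on k S h"
proof (cases k)
  case 0
  then show ?thesis
    using assms by (simp add: linear_continuous_on)
next
  case (Suc m)
  have h: "(h has_derivative h) (at x)" for x
    by (rule bounded_linear_imp_has_derivative[OF assms])
  then have "frechet_derivative h (at x) = h" for x
    using frechet_derivative_at[OF h] by simp
  then show ?thesis using h C_k_on_const by (auto simp: Suc differentiable_def)
qed

lemma C_k_on_add:
  assumes S: "open S"
  shows "C_k_on k S f \<Longrightarrow> C_k_on k S g \<Longrightarrow> C_k_on k S (\<lambda>x. f x + g x)"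
proof (induction k arbitrary: f g)
  case 0
  then show ?case by (simp add: continuous_on_add)
next
  case (Suc k)
  have D: "(\<lambda>x. f x + g x) differentiable at x"
    "frechet_derivative (\<lambda>x. f x + g x) (at x) v
      = frechet_derivative f (at x) v + frechet_derivative g (at x) v" if "x \<in> S" for x v
  proof -
    have H: "((\<lambda>x. f x + g x) has_derivative
        (\<lambda>v. frechet_derivative f (at x) v + frechet_derivative g (at x) v)) (at x)"
      using Suc.prems that by (intro has_derivative_add) (auto simp: frechet_derivative_works)
    then show "(\<lambda>x. f x + g x) differentiable at x"
      "frechet_derivative (\<lambda>x. f x + g x) (at x) v
      = frechet_derivative f (at x) v + frechet_derivative g (at x) v"
      using has_derivative_frechetD[OF H] by simp_all
  qed
  have "C_k_on k S (\<lambda>x. frechet_derivative (\<lambda>x. f x + g x) (at x) v)" for v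
    by (rule C_k_on_cong[OF S, where f = "\<lambda>x. frechet_derivative f (at x) v + frechet_derivative g (at x) v"])
      (use Suc D in auto)
  from D(1) this show ?case by (rule C_k_on_SucI)
qed

lemma C_k_on_mult:
  fixes f g :: "'a::real_normed_vector \<Rightarrow> real"
  assumes S: "open S"
  shows "C_k_on k S f \<Longrightarrow> C_k_on k S g \<Longrightarrow> C_k_on k S (\<lambda>x. f x * g x)"
proof (induction k arbitrary: f g)
  case 0
  then show ?case by (simp add: continuous_on_mult)
next
  case (Suc k)
  have D: "(\<lambda>x. f x * g x) differentiable at x"
    "frechet_derivative (\<lambda>x. f x * g x) (at x) v
      = f x * frechet_derivative g (at x) v + frechet_derivative f (at x) v * g x"
    if "x \<in> S" for x v
  proof -
    have H: "((\<lambda>x. f x * g x) has_derivative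
        (\<lambda>v. f x * frechet_derivative g (at x) v + frechet_derivative f (at x) v * g x)) (at x)"
      using Suc.prems that by (intro has_derivative_mult) (auto simp: frechet_derivative_works)
    then show "(\<lambda>x. f x * g x) differentiable at x"
      "frechet_derivative (\<lambda>x. f x * g x) (at x) v
      = f x * frechet_derivative g (at x) v + frechet_derivative f (at x) v * g x"
      using has_derivative_frechetD[OF H] by simp_all
  qed
  have "C_k_on k S (\<lambda>x. f x * frechet_derivative g (at x) v + frechet_derivative f (at x) v * g x)" for v
    by (intro C_k_on_add[OF S] Suc.IH C_k_on_SucD[OF Suc.prems(1)] C_k_on_SucD[OF Suc.prems(2)])
      (use Suc.prems in auto)
  then have "C_k_on k S (\<lambda>x. frechet_derivative (\<lambda>x. f x * g x) (at x) v)" for v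
    by (rule C_k_on_cong[OF S]) (use D in auto)
  from D(1) this show ?case by (rule C_k_on_SucI)
qed

text \<open>The derivative of \<open>1 / f\<close> is again a product of functions \<open>1 / f\<close> with a derivative of \<open>f\<close>, so the
  induction on \<open>k\<close> closes for a fixed \<open>f\<close>.\<close>
lemma C_k_on_inverse:
  fixes f :: "'a::real_normed_vector \<Rightarrow> real"
  assumes S: "open S"
  shows "C_k_on k S f \<Longrightarrow> (\<And>x. x \<in> S \<Longrightarrow> f x \<noteq> 0) \<Longrightarrow> C_k_on k S (\<lambda>x. inverse (f x))"
proof (induction k)
  case 0
  then show ?case by (simp add: continuous_on_inverse)
next
  case (Suc k)
  have D: "(\<lambda>x. inverse (f x)) differentiable at x"
    "frechet_derivative (\<lambda>x. inverse (f x)) (at x) v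
      = (- 1) * (inverse (f x) * frechet_derivative f (at x) v * inverse (f x))"
    if "x \<in> S" for x v
  proof -
    have H: "((\<lambda>x. inverse (f x)) has_derivative
        (\<lambda>v. - (inverse (f x) * frechet_derivative f (at x) v * inverse (f x)))) (at x)"
    proof (rule Deriv.has_derivative_inverse)
      show "f x \<noteq> 0" using Suc.prems(2) that .
      show "(f has_derivative frechet_derivative f (at x)) (at x)"
        using Suc.prems(1) that by (simp flip: frechet_derivative_works)
    qed
    show "(\<lambda>x. inverse (f x)) differentiable at x"
      using H by (rule has_derivative_frechetD)
    show "frechet_derivative (\<lambda>x. inverse (f x)) (at x) v
      = (- 1) * (inverse (f x) * frechet_derivative f (at x) v * inverse (f x))"
      by (simp only: has_derivative_frechetD(2)[OF H] mult_minus1)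
  qed
  have "C_k_on k S (\<lambda>x. (- 1) * (inverse (f x) * frechet_derivative f (at x) v * inverse (f x)))" for v
  proof (intro C_k_on_mult[OF S] C_k_on_const)
    show *: "C_k_on k S (\<lambda>x. inverse (f x))"
      using C_k_on_SucD[OF Suc.prems(1)] Suc.prems(2) by (rule Suc.IH)
    then show "C_k_on k S (\<lambda>x. inverse (f x))" .
    show "C_k_on k S (\<lambda>x. frechet_derivative f (at x) v)" using Suc.prems(1) by simp
  qed
  then have "C_k_on k S (\<lambda>x. frechet_derivative (\<lambda>x. inverse (f x)) (at x) v)" for v
    by (rule C_k_on_cong[OF S]) (use D in auto)
  from D(1) this show ?case by (rule C_k_on_SucI)
qed

text \<open>The mean value theorem, applied first along \<open>v\<close> and then along \<open>w\<close>.\<close>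
lemma mixed_difference_mean_value:
  fixes f :: "'a::real_normed_vector \<Rightarrow> real"
  assumes c: "C_k_on 2 S f"
    and h: "0 < h" and sub: "\<And>s t. 0 \<le> s \<Longrightarrow> s \<le> h \<Longrightarrow> 0 \<le> t \<Longrightarrow> t \<le> h \<Longrightarrow> z + s *\<^sub>R v + t *\<^sub>R w \<in> S"
  obtains s t where "0 < s" "s < h" "0 < t" "t < h"
    "f (z + h *\<^sub>R v + h *\<^sub>R w) - f (z + h *\<^sub>R v) - f (z + h *\<^sub>R w) + f z
      = h\<^sup>2 * frechet_derivative (\<lambda>x. frechet_derivative f (at x) v) (at (z + s *\<^sub>R v + t *\<^sub>R w)) w"
proof -
  let ?Dv = "\<lambda>x. frechet_derivative f (at x) v"
  have d1: "(f has_derivative frechet_derivative f (at x)) (at x)"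
    and d2: "(?Dv has_derivative frechet_derivative ?Dv (at x)) (at x)" if "x \<in> S" for x
    using c that by (auto simp: numeral_2_eq_2 frechet_derivative_works)
  have l1: "linear (frechet_derivative f (at x))" and l2: "linear (frechet_derivative ?Dv (at x))"
    if "x \<in> S" for x using d1[OF that] d2[OF that] has_derivative_linear by blast+
  define u where "u s = f (z + s *\<^sub>R v + h *\<^sub>R w) - f (z + s *\<^sub>R v)" for s
  have "(u has_derivative (\<lambda>k. k * (?Dv (z + s *\<^sub>R v + h *\<^sub>R w) - ?Dv (z + s *\<^sub>R v)))) (at s within {0..h})"
    if s: "0 \<le> s" "s \<le> h" for s
  proof -
    have m: "z + s *\<^sub>R v + h *\<^sub>R w \<in> S" "z + s *\<^sub>R v \<in> S"
      using sub[of s h] sub[of s 0] s h by auto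
    have e: "((\<lambda>s. z + s *\<^sub>R v + h *\<^sub>R w) has_derivative (\<lambda>k. k *\<^sub>R v)) (at s)"
      "((\<lambda>s. z + s *\<^sub>R v) has_derivative (\<lambda>k. k *\<^sub>R v)) (at s)"
      by (auto intro!: derivative_eq_intros)
    have "(u has_derivative (\<lambda>k. frechet_derivative f (at (z + s *\<^sub>R v + h *\<^sub>R w)) (k *\<^sub>R v)
        - frechet_derivative f (at (z + s *\<^sub>R v)) (k *\<^sub>R v))) (at s)"
      unfolding u_def
      by (intro has_derivative_diff has_derivative_compose[OF e(1) d1[OF m(1)]]
          has_derivative_compose[OF e(2) d1[OF m(2)]])
    then have "(u has_derivative (\<lambda>k. k * (?Dv (z + s *\<^sub>R v + h *\<^sub>R w) - ?Dv (z + s *\<^sub>R v)))) (at s)"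
      by (simp add: linear_cmul[OF l1[OF m(1)]] linear_cmul[OF l1[OF m(2)]] right_diff_distrib)
    then show ?thesis by (rule has_derivative_at_withinI)
  qed
  from mvt_simple[OF h this] obtain s where s: "s \<in> {0<..<h}"
    and us: "u h - u 0 = (h - 0) * (?Dv (z + s *\<^sub>R v + h *\<^sub>R w) - ?Dv (z + s *\<^sub>R v))"
    by auto
  define q where "q t = ?Dv (z + s *\<^sub>R v + t *\<^sub>R w)" for t
  have "(q has_derivative (\<lambda>k. k * frechet_derivative ?Dv (at (z + s *\<^sub>R v + t *\<^sub>R w)) w)) (at t within {0..h})"
    if t: "0 \<le> t" "t \<le> h" for t
  proof -
    have m: "z + s *\<^sub>R v + t *\<^sub>R w \<in> S" using sub s t by auto
    have e: "((\<lambda>t. z + s *\<^sub>R v + t *\<^sub>R w) has_derivative (\<lambda>k. k *\<^sub>R w)) (at t)"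
      by (auto intro!: derivative_eq_intros)
    have "(q has_derivative (\<lambda>k. frechet_derivative ?Dv (at (z + s *\<^sub>R v + t *\<^sub>R w)) (k *\<^sub>R w))) (at t)"
      unfolding q_def
      by (rule has_derivative_compose[OF e d2[OF m]])
    then have "(q has_derivative (\<lambda>k. k * frechet_derivative ?Dv (at (z + s *\<^sub>R v + t *\<^sub>R w)) w)) (at t)"
      by (simp add: linear_cmul[OF l2[OF m]])
    then show ?thesis by (rule has_derivative_at_withinI)
  qed
  from mvt_simple[OF h this] obtain t where t: "t \<in> {0<..<h}"
    and qt: "q h - q 0 = (h - 0) * frechet_derivative ?Dv (at (z + s *\<^sub>R v + t *\<^sub>R w)) w"
    by auto
  show ?thesis
  proof (rule that[of s t])
    show "f (z + h *\<^sub>R v + h *\<^sub>R w) - f (z + h *\<^sub>R v) - f (z + h *\<^sub>R w) + f z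
      = h\<^sup>2 * frechet_derivative ?Dv (at (z + s *\<^sub>R v + t *\<^sub>R w)) w"
      using us qt by (simp add: u_def q_def power2_eq_square)
  qed (use s t in auto)
qed

text \<open>The mixed difference is symmetric in \<open>v\<close> and \<open>w\<close>, so on arbitrarily small parallelograms both
  iterated derivatives take a common value, though at different points; continuity does the rest.\<close>
lemma frechet_derivative_commute:
  fixes f :: "'a::real_normed_vector \<Rightarrow> real"
  assumes c: "C_k_on 2 S f" and S: "open S" "z \<in> S"
  shows "frechet_derivative (\<lambda>x. frechet_derivative f (at x) v) (at z) w
       = frechet_derivative (\<lambda>x. frechet_derivative f (at x) w) (at z) v"
proof -
  define P where "P = (\<lambda>x. frechet_derivative (\<lambda>x. frechet_derivative f (at x) v) (at x) w)"
  define R where "R = (\<lambda>x. frechet_derivative (\<lambda>x. frechet_derivative f (at x) w) (at x) v)"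
  have cont: "isCont P z" "isCont R z"
    using c S by (auto simp: numeral_2_eq_2 P_def R_def continuous_on_eq_continuous_at)
  have "dist (P z) (R z) < 2 * e" if e: "e > 0" for e
  proof -
    have "eventually (\<lambda>x. x \<in> S \<and> dist (P x) (P z) < e \<and> dist (R x) (R z) < e) (nhds z)"
      using cont S e unfolding continuous_at tendsto_at_iff_tendsto_nhds
      by (intro eventually_conj tendstoD eventually_nhds_in_open) auto
    then obtain d where d: "d > 0"
      and ball: "\<And>x. dist x z < d \<Longrightarrow> x \<in> S \<and> dist (P x) (P z) < e \<and> dist (R x) (R z) < e"
      by (auto simp: eventually_nhds_metric)
    define h where "h = d / (2 * (norm v + norm w + 1))"
    have h: "h > 0" using d by (simp add: h_def add_nonneg_pos)
    have near: "dist (z + s *\<^sub>R v + t *\<^sub>R w) z < d" if "0 \<le> s" "s \<le> h" "0 \<le> t" "t \<le> h" for s t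
    proof -
      have "dist (z + s *\<^sub>R v + t *\<^sub>R w) z = norm (s *\<^sub>R v + t *\<^sub>R w)" by (simp add: dist_norm)
      also have "\<dots> \<le> s * norm v + t * norm w"
        using norm_triangle_ineq[of "s *\<^sub>R v" "t *\<^sub>R w"] that by simp
      also have "\<dots> \<le> h * norm v + h * norm w" using that by (intro add_mono mult_right_mono) auto
      also have "\<dots> < h * (2 * (norm v + norm w + 1))"
      proof -
        have "0 \<le> h * (norm v + norm w)" using h by simp
        then show ?thesis using h by (simp only: distrib_left distrib_right mult_1_right)
      qed
      also have "\<dots> = d"
      proof -
        have "norm v + norm w + 1 \<noteq> 0" by (smt (verit) norm_ge_zero)
        then show ?thesis by (simp add: h_def)
      qed
      finally show ?thesis .
    qed
    obtain s t where st: "0 < s" "s < h" "0 < t" "t < h"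
      "f (z + h *\<^sub>R v + h *\<^sub>R w) - f (z + h *\<^sub>R v) - f (z + h *\<^sub>R w) + f z = h\<^sup>2 * P (z + s *\<^sub>R v + t *\<^sub>R w)"
      unfolding P_def
      by (rule mixed_difference_mean_value[OF c h, of z v w]) (use near ball in auto)
    obtain s' t' where st': "0 < s'" "s' < h" "0 < t'" "t' < h"
      "f (z + h *\<^sub>R w + h *\<^sub>R v) - f (z + h *\<^sub>R w) - f (z + h *\<^sub>R v) + f z = h\<^sup>2 * R (z + s' *\<^sub>R w + t' *\<^sub>R v)"
      unfolding R_def
    proof (rule mixed_difference_mean_value[OF c h, of z w v])
      fix s t :: real assume "0 \<le> s" "s \<le> h" "0 \<le> t" "t \<le> h"
      then show "z + s *\<^sub>R w + t *\<^sub>R v \<in> S" using near[of t s] ball by (simp add: add_ac)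
    qed auto
    have "h\<^sup>2 * P (z + s *\<^sub>R v + t *\<^sub>R w) = h\<^sup>2 * R (z + s' *\<^sub>R w + t' *\<^sub>R v)"
    proof -
      have "z + h *\<^sub>R w + h *\<^sub>R v = z + h *\<^sub>R v + h *\<^sub>R w" by (simp add: add_ac)
      from st'(5)[unfolded this] st(5) show ?thesis by linarith
    qed
    then have "P (z + s *\<^sub>R v + t *\<^sub>R w) = R (z + s' *\<^sub>R w + t' *\<^sub>R v)"
      by (rule mult_left_cancel[THEN iffD1, rotated]) (use h in simp)
    moreover have "dist (P (z + s *\<^sub>R v + t *\<^sub>R w)) (P z) < e"
      using near[of s t] st ball by simp
    moreover have "dist (R (z + s' *\<^sub>R w + t' *\<^sub>R v)) (R z) < e"
      using near[of t' s'] st' ball by (simp add: add_ac)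
    ultimately show ?thesis by (auto simp: dist_real_def)
  qed
  from this[of "dist (P z) (R z) / 2"] have "P z = R z" by auto
  then show ?thesis by (simp add: P_def R_def)
qed

section \<open>Directional derivatives on the tangent bundle\<close>

text \<open>Both partial derivatives \<open>pdx\<close> and \<open>pdy\<close> are instances of this operator, and so are their
  contractions with a fixed vector.  One set of rules serves all of them, and contractions need no
  index sums.\<close>
definition dirder :: "(real^'k::finite) \<times> (real^'k) \<Rightarrow> 'k scalar \<Rightarrow> 'k scalar" where
  "dirder w f = (\<lambda>x y. deriv (\<lambda>t. f (x + t *\<^sub>R fst w) (y + t *\<^sub>R snd w)) 0)"

lemma pdx_eq_dirder: "pdx i = dirder (axis i 1, 0)"
  by (simp add: fun_eq_iff pdx_def pd_def dirder_def)

lemma pdy_eq_dirder: "pdy i = dirder (0, axis i 1)"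
  by (simp add: fun_eq_iff pdy_def pd_def dirder_def)

lemma dirder_eq_frechet_derivative:
  assumes "(\<lambda>z. f (fst z) (snd z)) differentiable (at (x, y))"
  shows "dirder w f x y = frechet_derivative (\<lambda>z. f (fst z) (snd z)) (at (x, y)) w"
proof -
  let ?F = "\<lambda>z. f (fst z) (snd z)"
  have d: "(?F has_derivative frechet_derivative ?F (at (x, y))) (at (x, y))"
    using assms by (simp add: frechet_derivative_works)
  have lin: "linear (frechet_derivative ?F (at (x, y)))"
    using assms by (rule linear_frechet_derivative)
  have e: "((\<lambda>t. (x, y) + t *\<^sub>R w) has_derivative (\<lambda>k. k *\<^sub>R w)) (at 0)"
    by (auto intro!: derivative_eq_intros)
  have "((\<lambda>t. ?F ((x, y) + t *\<^sub>R w)) has_derivative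
      (\<lambda>k. frechet_derivative ?F (at (x, y)) (k *\<^sub>R w))) (at 0)"
    by (rule has_derivative_compose[OF e]) (use d in simp)
  then have "((\<lambda>t. f (x + t *\<^sub>R fst w) (y + t *\<^sub>R snd w)) has_derivative
      (\<lambda>k. frechet_derivative ?F (at (x, y)) w * k)) (at 0)"
    by (simp add: linear_cmul[OF lin] mult.commute)
  then have "((\<lambda>t. f (x + t *\<^sub>R fst w) (y + t *\<^sub>R snd w)) has_field_derivative
      frechet_derivative ?F (at (x, y)) w) (at 0)"
    by (simp add: has_field_derivative_def)
  then show ?thesis by (simp add: dirder_def DERIV_imp_deriv)
qed

definition smooth_scalar :: "((real^'k::finite) \<times> (real^'k)) set \<Rightarrow> 'k scalar \<Rightarrow> bool" where
  "smooth_scalar D f \<longleftrightarrow> smooth_on D (\<lambda>z. f (fst z) (snd z))"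

locale tangent_domain =
  fixes D :: "((real^'k::finite) \<times> (real^'k)) set"
  assumes open_D: "open D"
begin

lemma smooth_scalar_frechet:
  assumes "smooth_scalar D f" "(x, y) \<in> D"
  shows "((\<lambda>z. f (fst z) (snd z)) has_derivative frechet_derivative (\<lambda>z. f (fst z) (snd z)) (at (x, y))) (at (x, y))"
    and "dirder w f x y = frechet_derivative (\<lambda>z. f (fst z) (snd z)) (at (x, y)) w"
    and "linear (frechet_derivative (\<lambda>z. f (fst z) (snd z)) (at (x, y)))"
proof -
  have "C_k_on (Suc 0) D (\<lambda>z. f (fst z) (snd z))"
    using assms by (auto simp: smooth_scalar_def smooth_on_def)
  then have d: "(\<lambda>z. f (fst z) (snd z)) differentiable (at (x, y))" using assms(2) by auto
  then show "((\<lambda>z. f (fst z) (snd z)) has_derivative frechet_derivative (\<lambda>z. f (fst z) (snd z)) (at (x, y))) (at (x, y))"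
    by (simp add: frechet_derivative_works)
  show "dirder w f x y = frechet_derivative (\<lambda>z. f (fst z) (snd z)) (at (x, y)) w"
    using d by (rule dirder_eq_frechet_derivative)
  show "linear (frechet_derivative (\<lambda>z. f (fst z) (snd z)) (at (x, y)))"
    using d by (rule linear_frechet_derivative)
qed

lemma dirder_eqI:
  assumes "((\<lambda>z. f (fst z) (snd z)) has_derivative f') (at (x, y))"
  shows "dirder w f x y = f' w"
proof -
  have "(\<lambda>z. f (fst z) (snd z)) differentiable (at (x, y))"
    using assms by (rule has_derivative_frechetD)
  then show ?thesis
    by (simp only: dirder_eq_frechet_derivative has_derivative_frechetD(2)[OF assms])
qed

lemma smooth_scalar_dirder [simp]:
  assumes "smooth_scalar D f"
  shows "smooth_scalar D (dirder w f)"
  unfolding smooth_scalar_def smooth_on_def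
proof
  fix k
  have "C_k_on (Suc k) D (\<lambda>z. f (fst z) (snd z))"
    using assms by (auto simp: smooth_scalar_def smooth_on_def)
  then have "C_k_on k D (\<lambda>z. frechet_derivative (\<lambda>z. f (fst z) (snd z)) (at z) w)"
    unfolding C_k_on.simps by blast
  then show "C_k_on k D (\<lambda>z. dirder w f (fst z) (snd z))"
    by (rule C_k_on_cong[OF open_D]) (use smooth_scalar_frechet(2)[OF assms, where w = w] in auto)
qed

lemma smooth_scalar_pdx [simp]: "smooth_scalar D f \<Longrightarrow> smooth_scalar D (pdx i f)"
  and smooth_scalar_pdy [simp]: "smooth_scalar D f \<Longrightarrow> smooth_scalar D (pdy i f)"
  by (simp_all add: pdx_eq_dirder pdy_eq_dirder)

lemma smooth_scalar_const [simp]: "smooth_scalar D (\<lambda>x y. c)"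
  by (simp add: smooth_scalar_def smooth_on_def C_k_on_const)

lemma smooth_scalar_fibre_coordinate [simp]: "smooth_scalar D (\<lambda>x y. y $ i)"
  by (simp add: smooth_scalar_def smooth_on_def C_k_on_bounded_linear
      bounded_linear_compose[OF bounded_linear_vec_nth bounded_linear_snd])

lemma smooth_scalar_add [simp]:
  "smooth_scalar D f \<Longrightarrow> smooth_scalar D g \<Longrightarrow> smooth_scalar D (\<lambda>x y. f x y + g x y)"
  by (simp add: smooth_scalar_def smooth_on_def C_k_on_add open_D)

lemma smooth_scalar_mult [simp]:
  "smooth_scalar D f \<Longrightarrow> smooth_scalar D g \<Longrightarrow> smooth_scalar D (\<lambda>x y. f x y * g x y)"
  by (simp add: smooth_scalar_def smooth_on_def C_k_on_mult open_D)

lemma smooth_scalar_diff [simp]: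
  assumes "smooth_scalar D f" "smooth_scalar D g"
  shows "smooth_scalar D (\<lambda>x y. f x y - g x y)"
  using smooth_scalar_add[OF assms(1) smooth_scalar_mult[OF smooth_scalar_const[of "-1"] assms(2)]]
  by simp

lemma smooth_scalar_power [simp]:
  assumes "smooth_scalar D f"
  shows "smooth_scalar D (\<lambda>x y. f x y ^ n)"
  by (induction n) (simp_all add: assms)

lemma smooth_scalar_sum [simp]:
  "(\<And>i. i \<in> I \<Longrightarrow> smooth_scalar D (f i)) \<Longrightarrow> smooth_scalar D (\<lambda>x y. \<Sum>i\<in>I. f i x y)"
  by (induction I rule: infinite_finite_induct) simp_all

lemma smooth_scalar_prod:
  "(\<And>i. i \<in> I \<Longrightarrow> smooth_scalar D (f i)) \<Longrightarrow> smooth_scalar D (\<lambda>x y. \<Prod>i\<in>I. f i x y)"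
  by (induction I rule: infinite_finite_induct) simp_all

lemma smooth_scalar_divide:
  assumes "smooth_scalar D f" "smooth_scalar D g" "\<And>x y. (x, y) \<in> D \<Longrightarrow> g x y \<noteq> 0"
  shows "smooth_scalar D (\<lambda>x y. f x y / g x y)"
proof -
  have "smooth_scalar D (\<lambda>x y. inverse (g x y))"
    unfolding smooth_scalar_def smooth_on_def
  proof
    fix k
    show "C_k_on k D (\<lambda>z. inverse (g (fst z) (snd z)))"
      by (rule C_k_on_inverse[OF open_D])
        (use assms(2,3) in \<open>auto simp: smooth_scalar_def smooth_on_def\<close>)
  qed
  then show ?thesis using smooth_scalar_mult[OF assms(1)] by (simp add: divide_inverse)
qed

lemma smooth_scalar_cong:
  assumes "smooth_scalar D f" "\<And>x y. (x, y) \<in> D \<Longrightarrow> f x y = g x y"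
  shows "smooth_scalar D g"
  unfolding smooth_scalar_def smooth_on_def
proof
  fix k
  show "C_k_on k D (\<lambda>z. g (fst z) (snd z))"
    by (rule C_k_on_cong[OF open_D, where f = "\<lambda>z. f (fst z) (snd z)"])
      (use assms in \<open>auto simp: smooth_scalar_def smooth_on_def\<close>)
qed

lemma dirder_cong:
  assumes "\<And>x y. (x, y) \<in> D \<Longrightarrow> f x y = g x y" "(x, y) \<in> D"
  shows "dirder w f x y = dirder w g x y"
proof -
  have "isCont (\<lambda>t. (x, y) + t *\<^sub>R w) 0" by (intro continuous_intros)
  then have "((\<lambda>t. (x, y) + t *\<^sub>R w) \<longlongrightarrow> (x, y) + 0 *\<^sub>R w) (nhds 0)"
    using tendsto_at_iff_tendsto_nhds[of "\<lambda>t. (x, y) + t *\<^sub>R w" 0] unfolding continuous_at by blast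
  then have "\<forall>\<^sub>F t in nhds 0. (x, y) + t *\<^sub>R w \<in> D"
    by (rule topological_tendstoD) (use open_D assms(2) in auto)
  then have "\<forall>\<^sub>F t in nhds 0. f (x + t *\<^sub>R fst w) (y + t *\<^sub>R snd w) = g (x + t *\<^sub>R fst w) (y + t *\<^sub>R snd w)"
    by eventually_elim (use assms(1) in \<open>cases w; auto\<close>)
  then show ?thesis unfolding dirder_def by (intro deriv_cong_ev) auto
qed

lemma dirder_const: "dirder w (\<lambda>x y. c) x y = 0"
  by (simp add: dirder_def)

lemma dirder_fibre_coordinate: "dirder w (\<lambda>x y. y $ i) x y = snd w $ i"
  by (rule dirder_eqI[where f' = "\<lambda>w. snd w $ i"])
    (auto intro!: bounded_linear_imp_has_derivative
      bounded_linear_compose[OF bounded_linear_vec_nth bounded_linear_snd])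

lemma dirder_add:
  assumes "smooth_scalar D f" "smooth_scalar D g" "(x, y) \<in> D"
  shows "dirder w (\<lambda>x y. f x y + g x y) x y = dirder w f x y + dirder w g x y"
  unfolding smooth_scalar_frechet(2)[OF assms(1,3)] smooth_scalar_frechet(2)[OF assms(2,3)]
  by (rule dirder_eqI)
    (use has_derivative_add[OF smooth_scalar_frechet(1)[OF assms(1,3)] smooth_scalar_frechet(1)[OF assms(2,3)]]
      in simp)

lemma dirder_mult:
  assumes "smooth_scalar D f" "smooth_scalar D g" "(x, y) \<in> D"
  shows "dirder w (\<lambda>x y. f x y * g x y) x y = f x y * dirder w g x y + dirder w f x y * g x y"
  unfolding smooth_scalar_frechet(2)[OF assms(1,3)] smooth_scalar_frechet(2)[OF assms(2,3)]
  by (rule dirder_eqI)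
    (use has_derivative_mult[OF smooth_scalar_frechet(1)[OF assms(1,3)] smooth_scalar_frechet(1)[OF assms(2,3)]]
      in simp)

lemma dirder_cmult:
  assumes "smooth_scalar D f" "(x, y) \<in> D"
  shows "dirder w (\<lambda>x y. c * f x y) x y = c * dirder w f x y"
  using dirder_mult[OF smooth_scalar_const assms] by (simp add: dirder_const)

lemma dirder_diff:
  assumes "smooth_scalar D f" "smooth_scalar D g" "(x, y) \<in> D"
  shows "dirder w (\<lambda>x y. f x y - g x y) x y = dirder w f x y - dirder w g x y"
  using dirder_add[OF assms(1) smooth_scalar_mult[OF smooth_scalar_const[of "-1"] assms(2)] assms(3)]
    dirder_cmult[OF assms(2,3), of w "-1"] by simp

lemma dirder_sum:
  assumes "\<And>i. i \<in> I \<Longrightarrow> smooth_scalar D (f i)" "(x, y) \<in> D"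
  shows "dirder w (\<lambda>x y. \<Sum>i\<in>I. f i x y) x y = (\<Sum>i\<in>I. dirder w (f i) x y)"
  using assms(1)
  by (induction I rule: infinite_finite_induct) (simp_all add: dirder_const dirder_add assms(2))

lemma dirder_commute:
  assumes f: "smooth_scalar D f" and z: "(x, y) \<in> D"
  shows "dirder v (dirder w f) x y = dirder w (dirder v f) x y"
proof -
  let ?F = "\<lambda>z. f (fst z) (snd z)"
  have *: "dirder v (dirder w f) x y
      = frechet_derivative (\<lambda>z. frechet_derivative ?F (at z) w) (at (x, y)) v" for v w
  proof -
    have "C_k_on (Suc (Suc 0)) D ?F" using f by (auto simp: smooth_scalar_def smooth_on_def)
    then have "(\<lambda>z. frechet_derivative ?F (at z) w) differentiable (at (x, y))"
      using z unfolding C_k_on.simps by blast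
    then have "frechet_derivative (\<lambda>z. frechet_derivative ?F (at z) w) (at (x, y))
        = frechet_derivative (\<lambda>z. dirder w f (fst z) (snd z)) (at (x, y))"
      by (rule frechet_derivative_transform_within_open[OF _ open_D z])
        (use smooth_scalar_frechet(2)[OF f, where w = w] in auto)
    then show ?thesis using smooth_scalar_frechet(2)[OF smooth_scalar_dirder[OF f] z] by simp
  qed
  have "C_k_on 2 D ?F" using f by (auto simp: smooth_scalar_def smooth_on_def)
  then show ?thesis using frechet_derivative_commute[OF _ open_D z] unfolding * by blast
qed

lemma dirder_linear_combination:
  assumes "smooth_scalar D f" "(x, y) \<in> D"
  shows "dirder (\<Sum>i\<in>I. c i *\<^sub>R w i) f x y = (\<Sum>i\<in>I. c i * dirder (w i) f x y)"
  using smooth_scalar_frechet[OF assms] by (simp add: linear_sum linear_cmul)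

lemma vertical_dirder:
  assumes "smooth_scalar D f" "(x, y) \<in> D"
  shows "dirder (0, w) f x y = (\<Sum>i\<in>UNIV. w $ i * pdy i f x y)"
proof -
  have "(0, w) = (\<Sum>i\<in>UNIV. w $ i *\<^sub>R (0 :: real^'k, axis i 1))"
    by (simp add: prod_eq_iff fst_sum snd_sum vec_eq_iff axis_def if_distrib cong: if_cong)
  then show ?thesis
    using dirder_linear_combination[OF assms, of "\<lambda>i. w $ i" "\<lambda>i. (0, axis i 1)" UNIV]
    by (simp add: pdy_eq_dirder)
qed

lemma horizontal_dirder:
  assumes "smooth_scalar D f" "(x, y) \<in> D"
  shows "dirder (w, 0) f x y = (\<Sum>i\<in>UNIV. w $ i * pdx i f x y)"
proof -
  have "(w, 0) = (\<Sum>i\<in>UNIV. w $ i *\<^sub>R (axis i 1, 0 :: real^'k))"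
    by (simp add: prod_eq_iff fst_sum snd_sum vec_eq_iff axis_def if_distrib cong: if_cong)
  then show ?thesis
    using dirder_linear_combination[OF assms, of "\<lambda>i. w $ i" "\<lambda>i. (axis i 1, 0)" UNIV]
    by (simp add: pdx_eq_dirder)
qed

abbreviation vert :: "real^'k \<Rightarrow> 'k scalar \<Rightarrow> 'k scalar" where "vert w \<equiv> dirder (0, w)"
abbreviation horiz :: "real^'k \<Rightarrow> 'k scalar \<Rightarrow> 'k scalar" where "horiz w \<equiv> dirder (w, 0)"

lemmas pdy_cong = dirder_cong[where w = "(0, axis i 1)", folded pdy_eq_dirder] for i
lemmas pdy_mult = dirder_mult[where w = "(0, axis i 1)", folded pdy_eq_dirder] for i
lemmas pdy_sum = dirder_sum[where w = "(0, axis i 1)", folded pdy_eq_dirder] for i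
lemmas pdy_commute = dirder_commute[where v = "(0, axis i 1)" and w = "(0, axis j 1)",
    folded pdy_eq_dirder] for i j

lemma pdy_fibre_coordinate: "pdy i (\<lambda>x y. y $ j) x y = (if i = j then 1 else 0)"
  by (simp add: pdy_eq_dirder dirder_fibre_coordinate axis_def)

lemma sum_axis [simp]: "(\<Sum>i\<in>UNIV. axis k (1::real) $ i * c i) = c k"
  by (simp add: axis_def if_distrib[of "\<lambda>t. t * _"] cong: if_cong)

lemma smooth_scalar_cdivide [simp]:
  "smooth_scalar D f \<Longrightarrow> smooth_scalar D (\<lambda>x y. f x y / c)"
  using smooth_scalar_mult[OF smooth_scalar_const[of "1 / c"]] by fastforce

lemma dirder_cdivide:
  assumes "smooth_scalar D f" "(x, y) \<in> D"
  shows "dirder w (\<lambda>x y. f x y / c) x y = dirder w f x y / c"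
  using dirder_cmult[OF assms, of w "1 / c"] by simp

lemmas pdy_cdivide = dirder_cdivide[where w = "(0, axis i 1)", folded pdy_eq_dirder] for i

text \<open>The next two lemmas return to indices, where the definitions of \<open>g\<close>, \<open>F\<close> and \<open>C\<close> require it.\<close>
lemma vert_vert:
  assumes "smooth_scalar D f" "(x, y) \<in> D"
  shows "vert v (vert w f) x y = (\<Sum>i\<in>UNIV. \<Sum>j\<in>UNIV. v $ i * w $ j * pdy i (pdy j f) x y)"
proof -
  have "vert v (vert w f) x y = vert v (\<lambda>x y. \<Sum>j\<in>UNIV. w $ j * pdy j f x y) x y"
    using assms by (intro dirder_cong) (auto simp: vertical_dirder)
  also have "\<dots> = (\<Sum>j\<in>UNIV. w $ j * vert v (pdy j f) x y)"
    using assms by (simp add: dirder_sum dirder_cmult)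
  also have "\<dots> = (\<Sum>j\<in>UNIV. \<Sum>i\<in>UNIV. v $ i * w $ j * pdy i (pdy j f) x y)"
    using assms by (simp add: vertical_dirder sum_distrib_left mult_ac)
  finally show ?thesis by (subst sum.swap)
qed

lemma vert_vert_vert:
  assumes "smooth_scalar D f" "(x, y) \<in> D"
  shows "vert u (vert v (vert w f)) x y
    = (\<Sum>i\<in>UNIV. \<Sum>j\<in>UNIV. \<Sum>k\<in>UNIV. u $ i * v $ j * w $ k * pdy i (pdy j (pdy k f)) x y)"
proof -
  have "vert u (vert v (vert w f)) x y
      = (\<Sum>i\<in>UNIV. \<Sum>j\<in>UNIV. u $ i * v $ j * pdy i (pdy j (vert w f)) x y)"
    using assms by (simp add: vert_vert)
  moreover have "pdy i (pdy j (vert w f)) x y = (\<Sum>k\<in>UNIV. w $ k * pdy i (pdy j (pdy k f)) x y)" for i j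
  proof -
    have "pdy j (vert w f) x y = (\<Sum>k\<in>UNIV. w $ k * pdy j (pdy k f) x y)" if "(x, y) \<in> D" for x y
    proof -
      have "pdy j (vert w f) x y = vert w (pdy j f) x y"
        unfolding pdy_eq_dirder by (rule dirder_commute[OF assms(1) that])
      then show ?thesis using assms(1) that by (simp add: vertical_dirder pdy_commute[of f x y j])
    qed
    then have "pdy i (pdy j (vert w f)) x y = pdy i (\<lambda>x y. \<Sum>k\<in>UNIV. w $ k * pdy j (pdy k f) x y) x y"
      using assms(2) by (rule pdy_cong)
    also have "\<dots> = (\<Sum>k\<in>UNIV. w $ k * pdy i (pdy j (pdy k f)) x y)"
      using assms by (simp add: pdy_eq_dirder dirder_sum dirder_cmult)
    finally show ?thesis .
  qed
  ultimately show ?thesis by (simp add: sum_distrib_left mult_ac)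
qed

section \<open>Homogeneity\<close>

text \<open>Homogeneity is taken in Euler's differential form, which is inherited by derivatives without
  reference to the scaling \<open>y \<mapsto> t y\<close>.\<close>
definition homogeneous :: "real \<Rightarrow> 'k scalar \<Rightarrow> bool" where
  "homogeneous r f \<longleftrightarrow> (\<forall>x y. (x, y) \<in> D \<longrightarrow> dirder (0, y) f x y = r * f x y)"

lemma homogeneousD:
  assumes "homogeneous r f" "smooth_scalar D f" "(x, y) \<in> D"
  shows "(\<Sum>i\<in>UNIV. y $ i * pdy i f x y) = r * f x y"
  using assms vertical_dirder[OF assms(2,3), of y] by (simp add: homogeneous_def)

text \<open>Differentiate Euler's identity along \<open>w\<close>; the last term comes from the coefficient \<open>y\<close> in it.\<close>
lemma euler_dirder:
  assumes f: "smooth_scalar D f" and h: "homogeneous r f" and z: "(x, y) \<in> D"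
  shows "dirder (0, y) (dirder w f) x y = r * dirder w f x y - dirder (0, snd w) f x y"
proof -
  have "dirder w (\<lambda>x y. \<Sum>i\<in>UNIV. y $ i * pdy i f x y) x y = dirder w (\<lambda>x y. r * f x y) x y"
    by (rule dirder_cong[OF _ z]) (rule homogeneousD[OF h f])
  moreover have "dirder w (\<lambda>x y. \<Sum>i\<in>UNIV. y $ i * pdy i f x y) x y
      = (\<Sum>i\<in>UNIV. y $ i * pdy i (dirder w f) x y) + dirder (0, snd w) f x y"
  proof -
    have "dirder w (pdy i f) x y = pdy i (dirder w f) x y" for i
      unfolding pdy_eq_dirder by (rule dirder_commute[OF f z])
    then show ?thesis
      using f z by (simp add: dirder_sum dirder_mult dirder_fibre_coordinate sum.distrib vertical_dirder)
  qed
  ultimately show ?thesis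
    using f z by (simp add: dirder_cmult vertical_dirder[where f = "dirder w f"])
qed

lemma homogeneous_vert:
  "smooth_scalar D f \<Longrightarrow> homogeneous r f \<Longrightarrow> homogeneous (r - 1) (vert w f)"
  unfolding homogeneous_def[of "r - 1"] by (simp add: euler_dirder algebra_simps)

lemma homogeneous_pdy:
  "smooth_scalar D f \<Longrightarrow> homogeneous r f \<Longrightarrow> homogeneous (r - 1) (pdy i f)"
  unfolding pdy_eq_dirder by (rule homogeneous_vert)

lemma homogeneous_pdx:
  "smooth_scalar D f \<Longrightarrow> homogeneous r f \<Longrightarrow> homogeneous r (pdx i f)"
  unfolding pdx_eq_dirder homogeneous_def[of r "dirder _ f"]
  by (auto simp: euler_dirder dirder_def[of "(0, 0)"])

end

section \<open>The spray of a Finsler function\<close>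

locale finsler_chart = tangent_domain D for D :: "((real^'k::finite) \<times> (real^'k)) set" +
  fixes L :: "'k scalar"
  assumes smooth_L [simp]: "smooth_scalar D L"
    and L_pos: "(x, y) \<in> D \<Longrightarrow> L x y > 0"
    and homogeneous_L: "homogeneous 1 L"
    and metric_pos: "(x, y) \<in> D \<Longrightarrow> w \<noteq> 0 \<Longrightarrow>
      (\<Sum>i\<in>UNIV. \<Sum>j\<in>UNIV. metric_g L i j x y * w $ i * w $ j) > 0"
begin

abbreviation Q :: "'k scalar" where "Q \<equiv> \<lambda>x y. (L x y)\<^sup>2"
abbreviation g :: "'k \<Rightarrow> 'k \<Rightarrow> 'k scalar" where "g \<equiv> metric_g L"
abbreviation G :: "'k \<Rightarrow> 'k scalar" where "G \<equiv> spray L"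

lemma dirder_Q:
  assumes "(x, y) \<in> D" shows "dirder w Q x y = 2 * L x y * dirder w L x y"
  using dirder_mult[OF smooth_L smooth_L assms] by (simp add: power2_eq_square)

lemma homogeneous_Q: "homogeneous 2 Q"
  using homogeneous_L by (auto simp: homogeneous_def dirder_Q) (simp add: power2_eq_square)

lemma smooth_metric [simp]: "smooth_scalar D (g i j)"
  by (simp add: metric_g_def)

lemma metric_sym: "(x, y) \<in> D \<Longrightarrow> g i j x y = g j i x y"
  by (simp add: metric_g_def pdy_commute[of Q])

text \<open>This replaces the inverse metric in uniqueness arguments: raising an index is needed only where a
  definition uses it.\<close>
lemma metric_cancel:
  assumes z: "(x, y) \<in> D"
    and eq: "\<And>j. (\<Sum>i\<in>UNIV. g j i x y * u i) = (\<Sum>i\<in>UNIV. g j i x y * w i)"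
  shows "u i = w i"
proof -
  define d :: "real^'k" where "d = (\<chi> i. u i - w i)"
  have "(\<Sum>i\<in>UNIV. g j i x y * d $ i) = 0" for j
    using eq[of j] by (simp add: d_def right_diff_distrib sum_subtractf)
  then have "(\<Sum>j\<in>UNIV. d $ j * (\<Sum>i\<in>UNIV. g j i x y * d $ i)) = 0" by simp
  then have "(\<Sum>j\<in>UNIV. \<Sum>i\<in>UNIV. g j i x y * d $ j * d $ i) = 0"
    by (simp add: sum_distrib_left mult_ac)
  then have "d = 0" using metric_pos[OF z, of d] by force
  then show ?thesis by (simp add: d_def vec_eq_iff)
qed

lemma metric_matrix_inverse:
  assumes z: "(x, y) \<in> D"
  defines "A \<equiv> (\<chi> i j. g i j x y)"
  shows "det A \<noteq> 0" and "A ** matrix_inv A = mat 1"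
proof -
  have "v = 0" if "A *v v = 0" for v
  proof -
    have "v $ i = 0" for i
      by (rule metric_cancel[OF z, of "\<lambda>i. v $ i" "\<lambda>i. 0"])
        (use that in \<open>simp add: A_def matrix_vector_mult_def vec_eq_iff\<close>)
    then show ?thesis by (simp add: vec_eq_iff)
  qed
  then have inv: "invertible A"
    unfolding invertible_left_inverse matrix_left_invertible_ker by blast
  then show "det A \<noteq> 0" by (simp add: invertible_det_nz)
  show "A ** matrix_inv A = mat 1"
    using someI_ex[OF inv[unfolded invertible_def]] by (simp add: matrix_inv_def)
qed

lemma metric_inv_right:
  assumes z: "(x, y) \<in> D"
  shows "(\<Sum>i\<in>UNIV. g j i x y * metric_inv L i k x y) = (if j = k then 1 else 0)"
  using metric_matrix_inverse(2)[OF z]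
  by (simp add: matrix_matrix_mult_def vec_eq_iff mat_def metric_inv_def)

lemma metric_lower_raise:
  assumes z: "(x, y) \<in> D"
  shows "(\<Sum>i\<in>UNIV. g j i x y * (\<Sum>k\<in>UNIV. metric_inv L i k x y * W k)) = W j"
proof -
  have "(\<Sum>i\<in>UNIV. g j i x y * (\<Sum>k\<in>UNIV. metric_inv L i k x y * W k))
      = (\<Sum>k\<in>UNIV. \<Sum>i\<in>UNIV. g j i x y * metric_inv L i k x y * W k)"
    by (subst sum.swap) (simp add: sum_distrib_left mult_ac)
  also have "\<dots> = (\<Sum>k\<in>UNIV. (if j = k then 1 else 0) * W k)"
    by (simp add: metric_inv_right[OF z] flip: sum_distrib_right)
  also have "\<dots> = W j" by (simp add: if_distrib[of "\<lambda>t. t * _"] cong: if_cong)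
  finally show ?thesis .
qed

text \<open>By Cramer's rule the entries of the inverse are rational functions of those of \<open>g\<close>.\<close>
lemma smooth_metric_inv [simp]: "smooth_scalar D (metric_inv L i j)"
proof -
  define A :: "real^'k \<Rightarrow> real^'k \<Rightarrow> real^'k^'k" where "A x y = (\<chi> i j. g i j x y)" for x y
  define N where "N x y = (\<chi> k l. if l = i then axis j 1 $ k else A x y $ k $ l)" for x y
  have smooth_det: "smooth_scalar D (\<lambda>x y. det (B x y))"
    if "\<And>k l. smooth_scalar D (\<lambda>x y. B x y $ k $ l)" for B :: "real^'k \<Rightarrow> real^'k \<Rightarrow> real^'k^'k"
    unfolding det_def by (intro smooth_scalar_sum smooth_scalar_mult smooth_scalar_const smooth_scalar_prod that)
  have "metric_inv L i j x y = det (N x y) / det (A x y)" if z: "(x, y) \<in> D" for x y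
  proof -
    have "A x y *v (matrix_inv (A x y) *v axis j 1) = axis j 1"
      using metric_matrix_inverse(2)[OF z] by (simp add: A_def matrix_vector_mul_assoc)
    then have "matrix_inv (A x y) *v axis j 1
        = (\<chi> k. det (\<chi> m l. if l = k then axis j 1 $ m else A x y $ m $ l) / det (A x y))"
      using cramer[of "A x y"] metric_matrix_inverse(1)[OF z] by (simp add: A_def)
    then have "(matrix_inv (A x y) *v axis j 1) $ i = det (N x y) / det (A x y)"
      by (simp add: N_def)
    then show ?thesis
      by (simp add: metric_inv_def A_def matrix_vector_mult_basis column_def)
  qed
  moreover have "smooth_scalar D (\<lambda>x y. det (N x y) / det (A x y))"
  proof (rule smooth_scalar_divide)
    have "smooth_scalar D (\<lambda>x y. N x y $ k $ l)" for k l
      by (cases "l = i") (simp_all add: N_def A_def)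
    then show "smooth_scalar D (\<lambda>x y. det (N x y))" by (rule smooth_det)
    show "smooth_scalar D (\<lambda>x y. det (A x y))" by (intro smooth_det) (simp add: A_def)
    show "det (A x y) \<noteq> 0" if "(x, y) \<in> D" for x y
      using metric_matrix_inverse(1)[OF that] by (simp add: A_def)
  qed
  ultimately show ?thesis using smooth_scalar_cong by (metis (no_types, lifting))
qed

lemma smooth_spray [simp]: "smooth_scalar D (G i)"
  by (simp add: spray_def)

lemma spray_lowered:
  assumes z: "(x, y) \<in> D"
  shows "(\<Sum>i\<in>UNIV. g j i x y * G i x y)
      = 1/4 * ((\<Sum>r\<in>UNIV. y $ r * pdy j (pdx r Q) x y) - pdx j Q x y)"
  using metric_lower_raise[OF z, of j "\<lambda>j. 1/4 * ((\<Sum>r\<in>UNIV. y $ r * pdy j (pdx r Q) x y) - pdx j Q x y)"]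
  by (simp add: spray_def sum_distrib_left mult_ac)

lemma homogeneous_metric: "homogeneous 0 (g i j)"
proof -
  have "homogeneous (2 - 1 - 1) (pdy i (pdy j Q))"
    by (intro homogeneous_pdy homogeneous_Q) simp_all
  then show ?thesis by (auto simp: homogeneous_def metric_g_def dirder_cdivide)
qed

text \<open>Apply the Euler operator to \<open>spray_lowered\<close>: \<open>g\<close> has degree 0 and the right-hand side degree 2,
  so \<open>g\<^sub>j\<^sub>i\<close> contracted with the Euler derivative of \<open>G\<^sup>i\<close> is \<open>2 g\<^sub>j\<^sub>i G\<^sup>i\<close>.\<close>
lemma homogeneous_spray: "homogeneous 2 (G i)"
  unfolding homogeneous_def
proof (intro allI impI)
  fix x y assume z: "(x, y) \<in> D"
  let ?S = "\<lambda>j x y. 1/4 * ((\<Sum>r\<in>UNIV. y $ r * pdy j (pdx r Q) x y) - pdx j Q x y)"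
  have h1: "dirder (0, y) (pdx j Q) x y = 2 * pdx j Q x y" for j
    using homogeneous_pdx[OF _ homogeneous_Q] z by (simp add: homogeneous_def)
  have h2: "dirder (0, y) (pdy j (pdx r Q)) x y = pdy j (pdx r Q) x y" for j r
    using homogeneous_pdy[OF _ homogeneous_pdx[OF _ homogeneous_Q]] z by (simp add: homogeneous_def)
  show "dirder (0, y) (G i) x y = 2 * G i x y"
  proof (rule metric_cancel[OF z])
    fix j
    have "(\<Sum>i\<in>UNIV. g j i x y * dirder (0, y) (G i) x y)
        = dirder (0, y) (\<lambda>x y. \<Sum>i\<in>UNIV. g j i x y * G i x y) x y"
      using homogeneous_metric z by (simp add: dirder_sum dirder_mult homogeneous_def)
    also have "\<dots> = dirder (0, y) (?S j) x y"
      by (rule dirder_cong[OF _ z]) (rule spray_lowered)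
    also have "\<dots> = 1/4 * ((\<Sum>r\<in>UNIV. y $ r * pdy j (pdx r Q) x y + y $ r * pdy j (pdx r Q) x y)
        - 2 * pdx j Q x y)"
      using z by (simp add: dirder_cdivide dirder_diff dirder_sum dirder_mult dirder_fibre_coordinate h1 h2)
    also have "\<dots> = 2 * ?S j x y" by (simp add: sum.distrib sum_distrib_left algebra_simps)
    also have "\<dots> = 2 * (\<Sum>i\<in>UNIV. g j i x y * G i x y)"
      by (simp only: spray_lowered[OF z])
    finally show "(\<Sum>i\<in>UNIV. g j i x y * dirder (0, y) (G i) x y)
        = (\<Sum>i\<in>UNIV. g j i x y * (2 * G i x y))"
      by (simp add: sum_distrib_left mult_ac)
  qed
qed

lemma metric_supporting:
  assumes z: "(x, y) \<in> D"
  shows "2 * (\<Sum>j\<in>UNIV. g i j x y * y $ j) = pdy i Q x y"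
proof -
  have "homogeneous (2 - 1) (pdy i Q)" by (intro homogeneous_pdy homogeneous_Q) simp
  from homogeneousD[OF this _ z] have "(\<Sum>j\<in>UNIV. y $ j * pdy j (pdy i Q) x y) = pdy i Q x y" by simp
  then show ?thesis
    using z by (simp add: metric_g_def sum_distrib_left pdy_commute[of Q x y i] mult_ac)
qed

text \<open>Thus \<open>\<delta>\<^sub>k L\<^sup>2 = 0\<close>.  Contracting \<open>spray_lowered\<close> with \<open>y\<close> gives \<open>2 Q\<^sub>i G\<^sup>i = y\<^sup>r \<partial>\<^sub>r Q\<close>.  Its derivative
  with respect to \<open>y\<^sup>k\<close> contains \<open>Q\<^sub>k\<^sub>i G\<^sup>i\<close>, which \<open>spray_lowered\<close> evaluates; the rest is the claim.\<close>
lemma energy_horizontal: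
  assumes z: "(x, y) \<in> D"
  shows "pdx k Q x y = (\<Sum>r\<in>UNIV. spray_conn L r k x y * pdy r Q x y)"
proof -
  have id: "(\<Sum>i\<in>UNIV. pdy i Q x y * G i x y) = 1/2 * (\<Sum>r\<in>UNIV. y $ r * pdx r Q x y)"
    if z: "(x, y) \<in> D" for x y
  proof -
    have e: "(\<Sum>j\<in>UNIV. y $ j * pdy j (pdx r Q) x y) = 2 * pdx r Q x y" for r
      using homogeneousD[OF homogeneous_pdx[OF _ homogeneous_Q] _ z] by simp
    have "(\<Sum>i\<in>UNIV. pdy i Q x y * G i x y)
        = (\<Sum>i\<in>UNIV. \<Sum>j\<in>UNIV. 2 * y $ j * (g i j x y * G i x y))"
      by (simp add: metric_supporting[OF z, symmetric] sum_distrib_left sum_distrib_right mult_ac)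
    also have "\<dots> = (\<Sum>j\<in>UNIV. 2 * y $ j * (\<Sum>i\<in>UNIV. g j i x y * G i x y))"
      by (subst sum.swap) (simp add: sum_distrib_left metric_sym[OF z])
    also have "\<dots> = (\<Sum>j\<in>UNIV. \<Sum>r\<in>UNIV. 1/2 * (y $ r * (y $ j * pdy j (pdx r Q) x y)))
        - (\<Sum>j\<in>UNIV. 1/2 * (y $ j * pdx j Q x y))"
      unfolding spray_lowered[OF z]
      by (simp add: sum_subtractf[symmetric] sum_distrib_left algebra_simps)
    also have "(\<Sum>j\<in>UNIV. \<Sum>r\<in>UNIV. 1/2 * (y $ r * (y $ j * pdy j (pdx r Q) x y)))
        = (\<Sum>r\<in>UNIV. 1/2 * (y $ r * (2 * pdx r Q x y)))"
      by (subst sum.swap) (simp only: e flip: sum_distrib_left)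
    finally show ?thesis by (simp add: sum_subtractf[symmetric] sum_distrib_left)
  qed
  have "pdy k (\<lambda>x y. \<Sum>i\<in>UNIV. pdy i Q x y * G i x y) x y
      = pdy k (\<lambda>x y. 1/2 * (\<Sum>r\<in>UNIV. y $ r * pdx r Q x y)) x y"
    by (rule pdy_cong[OF id z])
  then have "(\<Sum>i\<in>UNIV. pdy i Q x y * pdy k (G i) x y) + (\<Sum>i\<in>UNIV. pdy k (pdy i Q) x y * G i x y)
      = 1/2 * ((\<Sum>r\<in>UNIV. y $ r * pdy k (pdx r Q) x y) + pdx k Q x y)"
    using z by (simp add: pdy_sum pdy_mult pdy_cdivide pdy_fibre_coordinate sum.distrib
        if_distrib[of "\<lambda>t. t * _"] cong: if_cong)
  moreover have "(\<Sum>i\<in>UNIV. pdy k (pdy i Q) x y * G i x y)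
      = 1/2 * ((\<Sum>r\<in>UNIV. y $ r * pdy k (pdx r Q) x y) - pdx k Q x y)"
    using spray_lowered[OF z, of k] by (simp add: metric_g_def mult_ac flip: sum_divide_distrib)
  ultimately show ?thesis by (simp add: spray_conn_def mult.commute)
qed

text \<open>The property \<open>\<delta>\<^sub>k L\<^sup>2 = 0\<close> determines the spray among the functions of degree 2: inserted into the
  right-hand side of \<open>spray_lowered\<close>, it leaves \<open>g\<^sub>j\<^sub>s S\<^sup>s\<close> after Euler's theorem.\<close>
lemma spray_unique:
  assumes S [simp]: "\<And>i. smooth_scalar D (S i)" and hom: "\<And>i. homogeneous 2 (S i)"
    and hor: "\<And>x y k. (x, y) \<in> D \<Longrightarrow> pdx k Q x y = (\<Sum>r\<in>UNIV. pdy k (S r) x y * pdy r Q x y)"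
    and z: "(x, y) \<in> D"
  shows "G i x y = S i x y"
proof (rule metric_cancel[OF z])
  fix j
  have e1: "(\<Sum>r\<in>UNIV. y $ r * pdy r (S s) x y) = 2 * S s x y" for s
    using homogeneousD[OF hom _ z] by simp
  have "homogeneous (2 - 1) (pdy j (S s))" for s by (intro homogeneous_pdy hom) simp
  from homogeneousD[OF this _ z]
  have e2: "(\<Sum>r\<in>UNIV. y $ r * pdy j (pdy r (S s)) x y) = pdy j (S s) x y" for s
    using z by (simp add: pdy_commute[of "S s" x y j])
  have "pdy j (pdx r Q) x y = (\<Sum>s\<in>UNIV. pdy r (S s) x y * pdy j (pdy s Q) x y
      + pdy j (pdy r (S s)) x y * pdy s Q x y)" for r
    using z by (simp add: pdy_cong[OF hor z] pdy_sum pdy_mult)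
  then have "(\<Sum>r\<in>UNIV. y $ r * pdy j (pdx r Q) x y)
      = (\<Sum>r\<in>UNIV. \<Sum>s\<in>UNIV. y $ r * pdy r (S s) x y * pdy j (pdy s Q) x y
        + y $ r * pdy j (pdy r (S s)) x y * pdy s Q x y)"
    by (simp add: sum_distrib_left algebra_simps)
  also have "\<dots> = (\<Sum>s\<in>UNIV. 2 * S s x y * pdy j (pdy s Q) x y + pdy j (S s) x y * pdy s Q x y)"
    by (subst sum.swap) (simp only: sum.distrib e1 e2 flip: sum_distrib_right)
  also have "\<dots> = 4 * (\<Sum>s\<in>UNIV. g j s x y * S s x y) + pdx j Q x y"
    by (simp add: hor[OF z] sum.distrib metric_g_def sum_distrib_left mult_ac)
  finally show "(\<Sum>i\<in>UNIV. g j i x y * G i x y) = (\<Sum>i\<in>UNIV. g j i x y * S i x y)"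
    by (simp add: spray_lowered[OF z])
qed

end

context finsler_chart
begin

section \<open>The Cartan connection in terms of the spray\<close>

text \<open>This is \<open>\<delta>\<^sub>k f = 0\<close> on the whole domain.\<close>
definition horizontally_constant :: "'k scalar \<Rightarrow> bool" where
  "horizontally_constant f \<longleftrightarrow> (\<forall>x y. (x, y) \<in> D \<longrightarrow>
     (\<forall>k. pdx k f x y = (\<Sum>r\<in>UNIV. spray_conn L r k x y * pdy r f x y)))"

text \<open>This is \<open>T\<^sup>j \<delta>\<^sub>j\<close> for a constant vector \<open>T\<close>.\<close>
definition delta_along :: "real^'k \<Rightarrow> 'k scalar \<Rightarrow> 'k scalar" where
  "delta_along T f = (\<lambda>x y. horiz T f x y - (\<Sum>r\<in>UNIV. vert T (G r) x y * pdy r f x y))"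

lemma delta_eq_delta_along: "delta L j f = delta_along (axis j 1) f"
  by (simp add: fun_eq_iff delta_def delta_along_def spray_conn_def pdx_eq_dirder pdy_eq_dirder)

lemma horizontally_constant_Q: "horizontally_constant Q"
  by (simp add: horizontally_constant_def energy_horizontal)

lemma horizontally_constant_L: "horizontally_constant L"
  unfolding horizontally_constant_def
proof (intro allI impI)
  fix x y k assume z: "(x, y) \<in> D"
  have "2 * L x y * pdx k L x y = 2 * L x y * (\<Sum>r\<in>UNIV. spray_conn L r k x y * pdy r L x y)"
    using energy_horizontal[OF z, of k] z
    by (simp add: dirder_Q[OF z] pdx_eq_dirder pdy_eq_dirder sum_distrib_left mult_ac)
  then show "pdx k L x y = (\<Sum>r\<in>UNIV. spray_conn L r k x y * pdy r L x y)"
    using L_pos[OF z] by simp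
qed

text \<open>Differentiate \<open>\<delta>\<^sub>j f = 0\<close> twice with respect to \<open>y\<close>.  The derivatives of \<open>G\<^sup>r\<^sub>j\<close> appear because
  \<open>\<delta>\<^sub>j\<close> does not commute with vertical derivatives; the term with three derivatives of \<open>f\<close> completes
  \<open>\<partial>\<^sub>j\<close> to \<open>\<delta>\<^sub>j\<close>.\<close>
lemma delta_along_hessian:
  assumes f: "smooth_scalar D f" and hor: "horizontally_constant f" and z: "(x, y) \<in> D"
  shows "delta_along T (vert U (vert W f)) x y = (\<Sum>r\<in>UNIV.
      pdy r f x y * vert U (vert W (vert T (G r))) x y
      + vert W (vert T (G r)) x y * vert U (pdy r f) x y
      + vert U (vert T (G r)) x y * vert W (pdy r f) x y)"
proof -
  have 1: "horiz T f x y = (\<Sum>r\<in>UNIV. vert T (G r) x y * pdy r f x y)" if "(x, y) \<in> D" for x y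
  proof -
    have "horiz T f x y = (\<Sum>k\<in>UNIV. \<Sum>r\<in>UNIV. T $ k * pdy k (G r) x y * pdy r f x y)"
      using that f hor
      by (simp add: horizontal_dirder horizontally_constant_def spray_conn_def sum_distrib_left mult_ac)
    also have "\<dots> = (\<Sum>r\<in>UNIV. (\<Sum>k\<in>UNIV. T $ k * pdy k (G r) x y) * pdy r f x y)"
      by (subst sum.swap) (simp add: sum_distrib_right)
    finally show ?thesis using that by (simp add: vertical_dirder)
  qed
  have 2: "horiz T (vert W f) x y = (\<Sum>r\<in>UNIV. vert T (G r) x y * vert W (pdy r f) x y
      + vert W (vert T (G r)) x y * pdy r f x y)" if z: "(x, y) \<in> D" for x y
  proof -
    have "horiz T (vert W f) x y = vert W (horiz T f) x y"
      by (rule dirder_commute[OF f z])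
    also have "\<dots> = vert W (\<lambda>x y. \<Sum>r\<in>UNIV. vert T (G r) x y * pdy r f x y) x y"
      by (rule dirder_cong[OF 1 z])
    finally show ?thesis using f z by (simp add: dirder_sum dirder_mult)
  qed
  have "horiz T (vert U (vert W f)) x y = vert U (horiz T (vert W f)) x y"
    using f by (intro dirder_commute[OF _ z]) simp
  also have "\<dots> = vert U (\<lambda>x y. \<Sum>r\<in>UNIV. vert T (G r) x y * vert W (pdy r f) x y
      + vert W (vert T (G r)) x y * pdy r f x y) x y"
    by (rule dirder_cong[OF 2 z])
  also have "\<dots> = (\<Sum>r\<in>UNIV. (vert T (G r) x y * vert U (vert W (pdy r f)) x y
      + vert U (vert T (G r)) x y * vert W (pdy r f) x y)
      + (vert W (vert T (G r)) x y * vert U (pdy r f) x y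
      + vert U (vert W (vert T (G r))) x y * pdy r f x y))"
    using f z by (simp add: dirder_sum dirder_mult dirder_add)
  finally have 3: "horiz T (vert U (vert W f)) x y = \<dots>" .
  have "pdy r (vert U (vert W f)) x y = vert U (vert W (pdy r f)) x y" for r
  proof -
    have "pdy r (vert U (vert W f)) x y = vert U (pdy r (vert W f)) x y"
      unfolding pdy_eq_dirder using f by (intro dirder_commute[OF _ z]) simp
    also have "\<dots> = vert U (vert W (pdy r f)) x y"
      unfolding pdy_eq_dirder by (rule dirder_cong[OF dirder_commute[OF f] z])
    finally show ?thesis .
  qed
  then show ?thesis
    unfolding delta_along_def 3 by (simp add: sum_subtractf[symmetric] algebra_simps)
qed

lemma delta_metric:
  assumes z: "(x, y) \<in> D"
  shows "delta L j (g h k) x y = 1/2 * (\<Sum>r\<in>UNIV. pdy r Q x y * pdy h (pdy k (pdy j (G r))) x y)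
      + (\<Sum>r\<in>UNIV. g h r x y * pdy k (pdy j (G r)) x y)
      + (\<Sum>r\<in>UNIV. g k r x y * pdy h (pdy j (G r)) x y)"
proof -
  have "delta L j (g h k) x y = 1/2 * delta L j (pdy h (pdy k Q)) x y"
    using z by (simp add: delta_def metric_g_def pdx_eq_dirder pdy_eq_dirder dirder_cdivide
        sum_divide_distrib diff_divide_distrib)
  also have "delta L j (pdy h (pdy k Q)) x y = (\<Sum>r\<in>UNIV.
      pdy r Q x y * pdy h (pdy k (pdy j (G r))) x y
      + pdy k (pdy j (G r)) x y * pdy h (pdy r Q) x y
      + pdy h (pdy j (G r)) x y * pdy k (pdy r Q) x y)"
    using delta_along_hessian[OF _ horizontally_constant_Q z, of "axis j 1" "axis h 1" "axis k 1"]
    by (simp add: delta_eq_delta_along flip: pdy_eq_dirder)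
  also have "1/2 * \<dots> = 1/2 * (\<Sum>r\<in>UNIV. pdy r Q x y * pdy h (pdy k (pdy j (G r))) x y)
      + (\<Sum>r\<in>UNIV. g h r x y * pdy k (pdy j (G r)) x y)
      + (\<Sum>r\<in>UNIV. g k r x y * pdy h (pdy j (G r)) x y)"
    by (simp add: metric_g_def sum.distrib add_divide_distrib sum_divide_distrib mult_ac)
  finally show ?thesis .
qed

text \<open>In the Christoffel combination of \<open>delta_metric\<close> two pairs of the terms \<open>g\<^sub>h\<^sub>r G\<^sup>r\<^sub>j\<^sub>k\<close> cancel.  The
  remaining pair and one copy of the totally symmetric term \<open>Q\<^sub>r G\<^sup>r\<^sub>m\<^sub>j\<^sub>k\<close> survive.\<close>
lemma cartan_F_lowered:
  assumes z: "(x, y) \<in> D"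
  shows "(\<Sum>i\<in>UNIV. g m i x y * cartan_F L i j k x y)
      = (\<Sum>r\<in>UNIV. g m r x y * pdy k (pdy j (G r)) x y)
        + 1/4 * (\<Sum>r\<in>UNIV. pdy r Q x y * pdy m (pdy k (pdy j (G r))) x y)"
proof -
  have s2: "pdy a (pdy c (G r)) x y = pdy c (pdy a (G r)) x y" if "(x, y) \<in> D" for a c r x y
    by (rule pdy_commute[OF smooth_spray that])
  have s3: "pdy a (pdy c (pdy d (G r))) x y = pdy c (pdy a (pdy d (G r))) x y"
    "pdy a (pdy c (pdy d (G r))) x y = pdy a (pdy d (pdy c (G r))) x y" for a c d r
    by (simp add: pdy_commute z) (rule pdy_cong[OF s2 z])
  have d1: "delta L j (g m k) x y = 1/2 * (\<Sum>r\<in>UNIV. pdy r Q x y * pdy m (pdy k (pdy j (G r))) x y)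
      + (\<Sum>r\<in>UNIV. g m r x y * pdy k (pdy j (G r)) x y)
      + (\<Sum>r\<in>UNIV. g k r x y * pdy m (pdy j (G r)) x y)"
    by (rule delta_metric[OF z])
  have d2: "delta L k (g m j) x y = 1/2 * (\<Sum>r\<in>UNIV. pdy r Q x y * pdy m (pdy k (pdy j (G r))) x y)
      + (\<Sum>r\<in>UNIV. g m r x y * pdy k (pdy j (G r)) x y)
      + (\<Sum>r\<in>UNIV. g j r x y * pdy m (pdy k (G r)) x y)"
    unfolding delta_metric[OF z] by (simp only: s2[OF z, of j k] s3(2)[of m j k])
  have d3: "delta L m (g j k) x y = 1/2 * (\<Sum>r\<in>UNIV. pdy r Q x y * pdy m (pdy k (pdy j (G r))) x y)
      + (\<Sum>r\<in>UNIV. g j r x y * pdy m (pdy k (G r)) x y)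
      + (\<Sum>r\<in>UNIV. g k r x y * pdy m (pdy j (G r)) x y)"
    unfolding delta_metric[OF z]
    by (simp only: s2[OF z, of k m] s2[OF z, of j m] s3(2)[of j k m] s3(1)[of j m k] s3(2)[of m j k])
  have "(\<Sum>i\<in>UNIV. g m i x y * cartan_F L i j k x y)
      = 1/2 * (delta L j (g m k) x y + delta L k (g m j) x y - delta L m (g j k) x y)"
    using metric_lower_raise[OF z, of m
        "\<lambda>h. 1/2 * (delta L j (g h k) x y + delta L k (g h j) x y - delta L h (g j k) x y)"]
    by (simp add: cartan_F_def sum_distrib_left mult_ac)
  then show ?thesis unfolding d1 d2 d3 by simp
qed

text \<open>The functions \<open>G\<^sup>r\<^sub>k\<close> have degree 1 in \<open>y\<close> and their derivatives \<open>G\<^sup>r\<^sub>j\<^sub>k\<close> degree 0.  So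
  \<open>y\<^sup>j G\<^sup>r\<^sub>j\<^sub>k = G\<^sup>r\<^sub>k\<close>, and the third derivatives in \<open>cartan_F_lowered\<close> vanish when contracted with \<open>y\<close>.\<close>
lemma cartan_F_supporting:
  assumes z: "(x, y) \<in> D"
  shows "(\<Sum>j\<in>UNIV. cartan_F L i j k x y * y $ j) = spray_conn L i k x y"
proof (rule metric_cancel[OF z, of "\<lambda>i. \<Sum>j\<in>UNIV. cartan_F L i j k x y * y $ j"
      "\<lambda>i. spray_conn L i k x y"])
  fix m
  have "homogeneous (2 - 1) (pdy k (G r))" "homogeneous (2 - 1 - 1) (pdy m (pdy k (G r)))" for r
    by (intro homogeneous_pdy homogeneous_spray; simp)+
  note hom = homogeneousD[OF this(1) _ z] homogeneousD[OF this(2) _ z]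
  have e1: "(\<Sum>j\<in>UNIV. y $ j * pdy k (pdy j (G r)) x y) = pdy k (G r) x y" for r
    using hom(1)[of r] z by (simp add: pdy_commute[of "G r" x y k])
  have e2: "(\<Sum>j\<in>UNIV. y $ j * pdy m (pdy k (pdy j (G r))) x y) = 0" for r
  proof -
    have "pdy m (pdy k (pdy j (G r))) x y = pdy j (pdy m (pdy k (G r))) x y" for j
    proof -
      have "pdy m (pdy k (pdy j (G r))) x y = pdy m (pdy j (pdy k (G r))) x y"
        by (rule pdy_cong[OF _ z]) (simp add: pdy_commute)
      then show ?thesis using z by (simp add: pdy_commute[of _ x y m])
    qed
    then show ?thesis using hom(2)[of r] by simp
  qed
  have "(\<Sum>i\<in>UNIV. g m i x y * (\<Sum>j\<in>UNIV. cartan_F L i j k x y * y $ j))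
      = (\<Sum>j\<in>UNIV. y $ j * (\<Sum>i\<in>UNIV. g m i x y * cartan_F L i j k x y))"
    unfolding sum_distrib_left by (subst sum.swap) (simp add: mult_ac)
  also have "\<dots> = (\<Sum>j\<in>UNIV. \<Sum>r\<in>UNIV. g m r x y * (y $ j * pdy k (pdy j (G r)) x y)
        + 1/4 * pdy r Q x y * (y $ j * pdy m (pdy k (pdy j (G r))) x y))"
    by (simp add: cartan_F_lowered[OF z] sum.distrib sum_distrib_left algebra_simps)
  also have "\<dots> = (\<Sum>r\<in>UNIV. g m r x y * pdy k (G r) x y + 1/4 * pdy r Q x y * 0)"
    by (subst sum.swap) (simp only: sum.distrib e1 e2 flip: sum_distrib_left)
  finally show "(\<Sum>i\<in>UNIV. g m i x y * (\<Sum>j\<in>UNIV. cartan_F L i j k x y * y $ j))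
      = (\<Sum>i\<in>UNIV. g m i x y * spray_conn L i k x y)"
    by (simp add: spray_conn_def)
qed

end

section \<open>Parallel \<open>h\<close>-vectors\<close>

text \<open>The factor \<open>\<rho>\<close> enters only through its values: at each point there is a number with the stated
  property.\<close>
locale parallel_h_vector_chart = finsler_chart D L
  for D :: "((real^'k::finite) \<times> (real^'k)) set" and L +
  fixes b :: "'k \<Rightarrow> 'k scalar"
  assumes smooth_b [simp]: "smooth_scalar D (b i)"
    and h_vector: "(x, y) \<in> D \<Longrightarrow> \<exists>\<rho>. \<forall>i j. pdy j (b i) x y = \<rho> * pdy j (pdy i L) x y"
    and parallel: "(x, y) \<in> D \<Longrightarrow> hcov L b i j x y = 0"
begin

definition \<beta> :: "'k scalar" where "\<beta> = (\<lambda>x y. \<Sum>i\<in>UNIV. b i x y * y $ i)"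

lemma smooth_beta [simp]: "smooth_scalar D \<beta>"
  by (simp add: \<beta>_def)

lemma b_derivative_supporting:
  assumes z: "(x, y) \<in> D"
  shows "(\<Sum>i\<in>UNIV. y $ i * pdy j (b i) x y) = 0"
proof -
  obtain \<rho> where \<rho>: "\<And>i j. pdy j (b i) x y = \<rho> * pdy j (pdy i L) x y"
    using h_vector[OF z] by blast
  have "homogeneous (1 - 1) (pdy j L)" by (intro homogeneous_pdy homogeneous_L) simp
  from homogeneousD[OF this _ z] have "(\<Sum>i\<in>UNIV. y $ i * pdy i (pdy j L) x y) = 0" by simp
  then have "(\<Sum>i\<in>UNIV. y $ i * pdy j (pdy i L) x y) = 0"
    using z by (simp add: pdy_commute[of L x y j])
  then have "\<rho> * (\<Sum>i\<in>UNIV. y $ i * pdy j (pdy i L) x y) = 0" by simp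
  then show ?thesis by (simp add: \<rho> sum_distrib_left mult_ac)
qed

lemma pdy_beta:
  assumes z: "(x, y) \<in> D"
  shows "pdy j \<beta> x y = b j x y"
  using b_derivative_supporting[OF z, of j] z
  by (simp add: \<beta>_def pdy_sum pdy_mult pdy_fibre_coordinate sum.distrib mult.commute
      if_distrib[of "\<lambda>t. _ * t"] cong: if_cong)

lemma hessian_beta:
  assumes z: "(x, y) \<in> D"
  obtains \<rho> where "\<And>U W. vert U (vert W \<beta>) x y = \<rho> * vert U (vert W L) x y"
proof -
  obtain \<rho> where \<rho>: "\<And>i j. pdy j (b i) x y = \<rho> * pdy j (pdy i L) x y"
    using h_vector[OF z] by blast
  have "pdy i (pdy j \<beta>) x y = \<rho> * pdy i (pdy j L) x y" for i j
  proof -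
    have "pdy i (pdy j \<beta>) x y = pdy i (b j) x y" by (rule pdy_cong[OF pdy_beta z])
    then show ?thesis by (simp add: \<rho>)
  qed
  then have "vert U (vert W \<beta>) x y = \<rho> * vert U (vert W L) x y" for U W
    using z by (simp add: vert_vert sum_distrib_left mult_ac)
  then show ?thesis by (rule that)
qed

text \<open>Contract \<open>b\<^sub>i\<^sub>|\<^sub>k = 0\<close> with \<open>y\<^sup>i\<close>.  The vertical derivatives of \<open>b\<^sub>i\<close> do not contribute, because
  \<open>y\<^sup>i L\<^sub>i\<^sub>r = 0\<close>, and \<open>y\<^sup>i F\<^sup>r\<^sub>i\<^sub>k = G\<^sup>r\<^sub>k\<close>.\<close>
lemma horizontally_constant_beta: "horizontally_constant \<beta>"
  unfolding horizontally_constant_def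
proof (intro allI impI)
  fix x y k assume z: "(x, y) \<in> D"
  have "(\<Sum>i\<in>UNIV. y $ i * delta L k (b i) x y) = (\<Sum>i\<in>UNIV. y $ i * (\<Sum>r\<in>UNIV. b r x y * cartan_F L r i k x y))"
    using parallel[OF z] by (simp add: hcov_def)
  also have "\<dots> = (\<Sum>r\<in>UNIV. b r x y * (\<Sum>i\<in>UNIV. cartan_F L r i k x y * y $ i))"
    unfolding sum_distrib_left by (subst sum.swap) (simp add: mult_ac)
  also have "\<dots> = (\<Sum>r\<in>UNIV. spray_conn L r k x y * pdy r \<beta> x y)"
    unfolding cartan_F_supporting[OF z] by (simp add: pdy_beta[OF z] mult.commute)
  finally have 1: "(\<Sum>i\<in>UNIV. y $ i * delta L k (b i) x y) = \<dots>" .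
  have "(\<Sum>i\<in>UNIV. y $ i * delta L k (b i) x y) = (\<Sum>i\<in>UNIV. y $ i * pdx k (b i) x y)
      - (\<Sum>i\<in>UNIV. \<Sum>r\<in>UNIV. spray_conn L r k x y * (y $ i * pdy r (b i) x y))"
    by (simp add: delta_def right_diff_distrib sum_subtractf sum_distrib_left mult_ac)
  also have "(\<Sum>i\<in>UNIV. \<Sum>r\<in>UNIV. spray_conn L r k x y * (y $ i * pdy r (b i) x y)) = 0"
    by (subst sum.swap) (simp add: b_derivative_supporting[OF z] flip: sum_distrib_left)
  also have "(\<Sum>i\<in>UNIV. y $ i * pdx k (b i) x y) = pdx k \<beta> x y"
    using z by (simp add: \<beta>_def pdx_eq_dirder dirder_sum dirder_mult dirder_fibre_coordinate mult.commute)
  finally show "pdx k \<beta> x y = (\<Sum>r\<in>UNIV. spray_conn L r k x y * pdy r \<beta> x y)" using 1 by simp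
qed

text \<open>The factor \<open>\<rho>\<close> is known only pointwise, so it is eliminated before differentiating: on the whole
  domain \<open>\<beta>\<^sub>B\<^sub>T L\<^sub>B\<^sub>B = \<beta>\<^sub>B\<^sub>B L\<^sub>B\<^sub>T\<close>.  At a point where \<open>L\<^sub>B\<^sub>T\<close>, hence also \<open>\<beta>\<^sub>B\<^sub>T\<close>, vanishes, the product rule
  leaves only the derivatives of these two factors.\<close>
lemma hessian_beta_derivative:
  assumes z: "(x, y) \<in> D"
    and \<rho>: "\<And>U W. vert U (vert W \<beta>) x y = \<rho> * vert U (vert W L) x y"
    and BB: "vert B (vert B L) x y \<noteq> 0" and BT: "vert B (vert T L) x y = 0"
  shows "dirder w (vert B (vert T \<beta>)) x y = \<rho> * dirder w (vert B (vert T L)) x y"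
proof -
  have "dirder w (\<lambda>x y. vert B (vert T \<beta>) x y * vert B (vert B L) x y) x y
      = dirder w (\<lambda>x y. vert B (vert B \<beta>) x y * vert B (vert T L) x y) x y"
  proof (rule dirder_cong[OF _ z])
    fix x y assume "(x, y) \<in> D"
    then obtain \<sigma> where "\<And>U W. vert U (vert W \<beta>) x y = \<sigma> * vert U (vert W L) x y"
      using hessian_beta by blast
    then show "vert B (vert T \<beta>) x y * vert B (vert B L) x y
        = vert B (vert B \<beta>) x y * vert B (vert T L) x y" by simp
  qed
  then have "dirder w (vert B (vert T \<beta>)) x y * vert B (vert B L) x y
      = \<rho> * vert B (vert B L) x y * dirder w (vert B (vert T L)) x y"
    using z by (simp add: dirder_mult \<rho> BT)
  then show ?thesis using BB by simp
qed

lemma vert_combination: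
  assumes p: "smooth_scalar D p" and s: "smooth_scalar D s" and \<Psi>: "smooth_scalar D \<Psi>"
    and grad: "\<And>x y i. (x, y) \<in> D \<Longrightarrow> pdy i \<Psi> x y = p x y * pdy i L x y + s x y * pdy i \<beta> x y"
    and z: "(x, y) \<in> D"
  shows "vert W \<Psi> x y = p x y * vert W L x y + s x y * vert W \<beta> x y"
  using z \<Psi> by (simp add: vertical_dirder grad sum.distrib sum_distrib_left algebra_simps)

text \<open>For a function \<open>\<Psi>\<close> with gradient \<open>p L\<^sub>i + s \<beta>\<^sub>i\<close> and a vector \<open>B\<close> on which the gradients of \<open>L\<close> and
  \<open>\<beta>\<close> vanish at \<open>(x, y)\<close>, the derivatives of \<open>\<Psi>\<close> with one normal argument \<open>B\<close> are those of \<open>L\<close> times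
  \<open>p + s \<rho>\<close>; in third derivatives the other two arguments are taken orthogonal to \<open>B\<close>.\<close>
context
  fixes x y B p s \<Psi> \<rho>
  assumes p [simp]: "smooth_scalar D p" and s [simp]: "smooth_scalar D s" and \<Psi> [simp]: "smooth_scalar D \<Psi>"
    and grad: "\<And>x y i. (x, y) \<in> D \<Longrightarrow> pdy i \<Psi> x y = p x y * pdy i L x y + s x y * pdy i \<beta> x y"
    and z: "(x, y) \<in> D"
    and BL: "vert B L x y = 0" and Bb: "vert B \<beta> x y = 0"
    and BB: "vert B (vert B L) x y \<noteq> 0"
    and \<rho>: "\<And>U W. vert U (vert W \<beta>) x y = \<rho> * vert U (vert W L) x y"
begin

lemma normal_hessian:
  "vert U (vert B \<Psi>) x y = (p x y + s x y * \<rho>) * vert U (vert B L) x y"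
proof -
  have "vert U (vert B \<Psi>) x y = vert U (\<lambda>x y. p x y * vert B L x y + s x y * vert B \<beta> x y) x y"
    by (rule dirder_cong[OF _ z]) (rule vert_combination[OF p s \<Psi> grad])
  then show ?thesis
    using z BL Bb \<rho> by (simp add: dirder_add dirder_mult algebra_simps)
qed

lemma normal_third_derivative:
  assumes T: "vert T (vert B L) x y = 0" and U: "vert U (vert B L) x y = 0"
  shows "vert U (vert T (vert B \<Psi>)) x y = (p x y + s x y * \<rho>) * vert U (vert T (vert B L)) x y"
proof -
  have "vert T (vert B \<Psi>) x y = p x y * vert T (vert B L) x y + vert T p x y * vert B L x y
      + (s x y * vert T (vert B \<beta>) x y + vert T s x y * vert B \<beta> x y)" if z: "(x, y) \<in> D" for x y
  proof -
    have "vert T (vert B \<Psi>) x y = vert T (\<lambda>x y. p x y * vert B L x y + s x y * vert B \<beta> x y) x y"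
      by (rule dirder_cong[OF _ z]) (rule vert_combination[OF p s \<Psi> grad])
    then show ?thesis using z by (simp add: dirder_add dirder_mult)
  qed
  then have "vert U (vert T (vert B \<Psi>)) x y
      = vert U (\<lambda>x y. p x y * vert T (vert B L) x y + vert T p x y * vert B L x y
      + (s x y * vert T (vert B \<beta>) x y + vert T s x y * vert B \<beta> x y)) x y"
    using z by (intro dirder_cong)
  also have "\<dots> = p x y * vert U (vert T (vert B L)) x y + s x y * vert U (vert T (vert B \<beta>)) x y"
    using z BL Bb T U by (simp add: dirder_add dirder_mult \<rho>)
  also have "vert U (vert T (vert B \<beta>)) x y = \<rho> * vert U (vert T (vert B L)) x y"
  proof -
    have c: "vert U (vert T (vert B f)) x y = vert U (vert B (vert T f)) x y" if "smooth_scalar D f" for f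
      by (rule dirder_cong[OF dirder_commute[OF that] z])
    have "vert B (vert T L) x y = 0" using T dirder_commute[OF smooth_L z] by metis
    then show ?thesis
      unfolding c[OF smooth_L] c[OF smooth_beta] by (rule hessian_beta_derivative[OF z \<rho> BB])
  qed
  finally show ?thesis by (simp add: algebra_simps)
qed

text \<open>By \<open>delta_along_hessian\<close> the sum \<open>\<Sum>r. f\<^sub>r G\<^sup>r\<^sub>B\<^sub>U\<^sub>T\<close> is determined by \<open>\<delta>\<^sub>T f\<^sub>B\<^sub>U\<close> and the Hessian of \<open>f\<close>.  For
  \<open>f = \<beta>\<close> both are \<open>\<rho>\<close> times their values for \<open>f = L\<close>.\<close>
lemma normal_connection_term:
  assumes U: "vert B (vert U L) x y = 0"
  shows "(\<Sum>r\<in>UNIV. pdy r \<Psi> x y * vert B (vert U (vert T (G r))) x y)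
      = (p x y + s x y * \<rho>) * (\<Sum>r\<in>UNIV. pdy r L x y * vert B (vert U (vert T (G r))) x y)"
proof -
  have d: "dirder w (vert B (vert U \<beta>)) x y = \<rho> * dirder w (vert B (vert U L)) x y" for w
    by (rule hessian_beta_derivative[OF z \<rho> BB U])
  then have "delta_along T (vert B (vert U \<beta>)) x y = \<rho> * delta_along T (vert B (vert U L)) x y"
    by (simp add: delta_along_def pdy_eq_dirder sum_distrib_left right_diff_distrib mult_ac)
  moreover have "vert V (pdy r \<beta>) x y = \<rho> * vert V (pdy r L) x y" for V r
    unfolding pdy_eq_dirder by (rule \<rho>)
  ultimately have "(\<Sum>r\<in>UNIV. pdy r \<beta> x y * vert B (vert U (vert T (G r))) x y)
      = \<rho> * (\<Sum>r\<in>UNIV. pdy r L x y * vert B (vert U (vert T (G r))) x y)"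
    unfolding delta_along_hessian[OF smooth_beta horizontally_constant_beta z]
      delta_along_hessian[OF smooth_L horizontally_constant_L z]
    by (simp add: sum.distrib sum_distrib_left algebra_simps)
  moreover have "(\<Sum>r\<in>UNIV. pdy r \<Psi> x y * vert B (vert U (vert T (G r))) x y)
      = p x y * (\<Sum>r\<in>UNIV. pdy r L x y * vert B (vert U (vert T (G r))) x y)
        + s x y * (\<Sum>r\<in>UNIV. pdy r \<beta> x y * vert B (vert U (vert T (G r))) x y)"
    by (simp add: grad[OF z] sum.distrib sum_distrib_left algebra_simps)
  ultimately show ?thesis by (simp add: algebra_simps)
qed

end

end

section \<open>The second fundamental form of a hypersurface\<close>

definition tangent_vector :: "(real^'m::finite \<Rightarrow> real^'n::finite) \<Rightarrow> real^'m \<Rightarrow> 'm \<Rightarrow> real^'n" where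
  "tangent_vector X u \<alpha> = (\<chi> i. proj X i \<alpha> u)"

lemma supp_elt_eq: "supp_elt X u v = (\<Sum>\<alpha>\<in>UNIV. v $ \<alpha> *\<^sub>R tangent_vector X u \<alpha>)"
  by (simp add: supp_elt_def tangent_vector_def vec_eq_iff mult.commute)

text \<open>The part of \<open>H\<^sub>\<alpha>\<^sub>\<beta>\<close> that is linear in the normal vector.\<close>
definition normal_curvature ::
    "'n::finite scalar \<Rightarrow> (real^'m::finite \<Rightarrow> real^'n) \<Rightarrow> real^'m \<Rightarrow> real^'m \<Rightarrow> real^'n \<Rightarrow>
     'm \<Rightarrow> 'm \<Rightarrow> real" where
  "normal_curvature L X u v B \<alpha> \<gamma> = (\<Sum>i\<in>UNIV. normal_low L X u v B i *
     (proj2 X i \<alpha> \<gamma> u +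
      (\<Sum>j\<in>UNIV. \<Sum>k\<in>UNIV.
         cartan_F L i j k (X u) (supp_elt X u v) * proj X j \<alpha> u * proj X k \<gamma> u)))"

lemma H2_eq: "H2 L X u v B \<alpha> \<gamma> = normal_curvature L X u v B \<alpha> \<gamma> + M1 L X u v B \<alpha> * H1 L X u v B \<gamma>"
  by (simp add: H2_def normal_curvature_def)

text \<open>The four scaling lemmas below hold for every vector in place of the unit normal, which makes the
  normalisation \<open>g(B, B) = 1\<close> immaterial for the vanishing of these quantities.\<close>
lemma normal_low_scaleR: "normal_low L X u v (c *\<^sub>R B) i = c * normal_low L X u v B i"
  by (simp add: normal_low_def sum_distrib_left mult_ac)

lemma H1_scaleR: "H1 L X u v (c *\<^sub>R B) \<alpha> = c * H1 L X u v B \<alpha>"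
  by (simp add: H1_def normal_low_scaleR sum_distrib_left mult.assoc)

lemma normal_curvature_scaleR:
  "normal_curvature L X u v (c *\<^sub>R B) \<alpha> \<gamma> = c * normal_curvature L X u v B \<alpha> \<gamma>"
  by (simp add: normal_curvature_def normal_low_scaleR sum_distrib_left mult.assoc)

lemma M2_scaleR: "M2 L X u v (c *\<^sub>R B) \<alpha> \<gamma> = c * M2 L X u v B \<alpha> \<gamma>"
  by (simp add: M2_def sum_distrib_left mult_ac)

lemma sum_reverse3:
  "(\<Sum>i\<in>I. \<Sum>j\<in>J. \<Sum>k\<in>K. h i j k) = (\<Sum>k\<in>K. \<Sum>j\<in>J. \<Sum>i\<in>I. h i j k :: real)"
proof -
  have "(\<Sum>i\<in>I. \<Sum>j\<in>J. \<Sum>k\<in>K. h i j k) = (\<Sum>j\<in>J. \<Sum>i\<in>I. \<Sum>k\<in>K. h i j k)"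
    by (rule sum.swap)
  also have "\<dots> = (\<Sum>j\<in>J. \<Sum>k\<in>K. \<Sum>i\<in>I. h i j k)"
    by (rule sum.cong[OF refl]) (rule sum.swap)
  also have "\<dots> = (\<Sum>k\<in>K. \<Sum>j\<in>J. \<Sum>i\<in>I. h i j k)"
    by (rule sum.swap)
  finally show ?thesis .
qed

lemma sum_pull_out:
  "(\<Sum>i\<in>I. a i * (\<Sum>j\<in>J. \<Sum>k\<in>K. h i j k * s j * t k))
    = (\<Sum>j\<in>J. \<Sum>k\<in>K. s j * t k * (\<Sum>i\<in>I. a i * h i j k :: real))"
proof -
  have "(\<Sum>i\<in>I. a i * (\<Sum>j\<in>J. \<Sum>k\<in>K. h i j k * s j * t k))
      = (\<Sum>i\<in>I. \<Sum>j\<in>J. \<Sum>k\<in>K. s j * t k * (a i * h i j k))"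
    by (simp add: sum_distrib_left mult_ac)
  also have "\<dots> = (\<Sum>j\<in>J. \<Sum>i\<in>I. \<Sum>k\<in>K. s j * t k * (a i * h i j k))"
    by (rule sum.swap)
  also have "\<dots> = (\<Sum>j\<in>J. \<Sum>k\<in>K. \<Sum>i\<in>I. s j * t k * (a i * h i j k))"
    by (rule sum.cong[OF refl]) (rule sum.swap)
  finally show ?thesis by (simp add: sum_distrib_left)
qed

context finsler_chart
begin

lemma metric_pairing:
  assumes z: "(x, y) \<in> D"
  shows "(\<Sum>i\<in>UNIV. \<Sum>j\<in>UNIV. g i j x y * a $ i * c $ j) = 1/2 * vert a (vert c Q) x y"
  using z by (simp add: vert_vert metric_g_def sum_distrib_left mult_ac)

lemma normal_low_eq:
  assumes z: "(X u, supp_elt X u v) \<in> D"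
  shows "normal_low L X u v B i = 1/2 * pdy i (vert B Q) (X u) (supp_elt X u v)"
proof -
  have "vert (axis i 1) (vert B Q) (X u) (supp_elt X u v)
      = (\<Sum>j\<in>UNIV. B $ j * pdy i (pdy j Q) (X u) (supp_elt X u v))"
    by (subst vert_vert[OF _ z]) (simp_all add: mult.assoc flip: sum_distrib_left)
  then show ?thesis
    by (simp add: normal_low_def metric_g_def sum_divide_distrib mult_ac flip: pdy_eq_dirder)
qed

lemma H1_eq:
  assumes z: "(X u, supp_elt X u v) \<in> D"
  shows "H1 L X u v B \<alpha> = (\<Sum>i\<in>UNIV. normal_low L X u v B i *
     ((\<Sum>\<gamma>\<in>UNIV. proj2 X i \<gamma> \<alpha> u * v $ \<gamma>)
       + vert (tangent_vector X u \<alpha>) (G i) (X u) (supp_elt X u v)))"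
  using z by (simp add: H1_def spray_conn_def vertical_dirder tangent_vector_def mult.commute)

lemma vert_supp_elt:
  assumes z: "(X u, supp_elt X u v) \<in> D" and f: "smooth_scalar D f"
  shows "vert (supp_elt X u v) f (X u) (supp_elt X u v)
    = (\<Sum>\<alpha>\<in>UNIV. v $ \<alpha> * vert (tangent_vector X u \<alpha>) f (X u) (supp_elt X u v))"
proof -
  have "(0, supp_elt X u v) = (\<Sum>\<alpha>\<in>UNIV. v $ \<alpha> *\<^sub>R (0 :: real^'k, tangent_vector X u \<alpha>))"
    by (simp add: prod_eq_iff fst_sum snd_sum supp_elt_eq)
  then show ?thesis using dirder_linear_combination[OF f z] by metis
qed

lemma cartan_contraction:
  assumes z: "(x, y) \<in> D"
  shows "(\<Sum>i\<in>UNIV. \<Sum>j\<in>UNIV. \<Sum>k\<in>UNIV. cartan_tensor L i j k x y * a $ i * c $ j * d $ k)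
    = 1/4 * vert d (vert c (vert a Q)) x y"
proof -
  have C: "cartan_tensor L i j k x y = 1/4 * pdy k (pdy j (pdy i Q)) x y" for i j k
  proof -
    have "pdy k (g i j) x y = pdy k (\<lambda>x y. pdy j (pdy i Q) x y / 2) x y"
      by (rule pdy_cong[OF _ z]) (simp add: metric_g_def pdy_commute[of Q _ _ j i])
    then show ?thesis using z by (simp add: cartan_tensor_def pdy_cdivide)
  qed
  have "(\<Sum>i\<in>UNIV. \<Sum>j\<in>UNIV. \<Sum>k\<in>UNIV. cartan_tensor L i j k x y * a $ i * c $ j * d $ k)
      = (\<Sum>i\<in>UNIV. \<Sum>j\<in>UNIV. \<Sum>k\<in>UNIV. 1/4 * (d $ k * c $ j * a $ i * pdy k (pdy j (pdy i Q)) x y))"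
    unfolding C by (simp add: mult_ac)
  also have "\<dots> = 1/4 * vert d (vert c (vert a Q)) x y"
    using z by (subst sum_reverse3) (simp only: vert_vert_vert smooth_scalar_power smooth_L sum_distrib_left)
  finally show ?thesis .
qed

lemma M2_eq:
  assumes z: "(X u, supp_elt X u v) \<in> D"
  shows "M2 L X u v B \<alpha> \<gamma> = 1/4 * vert (tangent_vector X u \<gamma>) (vert (tangent_vector X u \<alpha>) (vert B Q))
      (X u) (supp_elt X u v)"
  using cartan_contraction[OF z, of B "tangent_vector X u \<alpha>" "tangent_vector X u \<gamma>"]
  by (simp add: M2_def tangent_vector_def)

text \<open>Contracting with \<open>v\<close> replaces one tangent vector by \<open>y\<close>, and the Cartan tensor annihilates \<open>y\<close>
  because \<open>g\<close> has degree 0.\<close>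
lemma M1_supporting:
  assumes z: "(X u, supp_elt X u v) \<in> D"
  shows "(\<Sum>\<alpha>\<in>UNIV. v $ \<alpha> * M1 L X u v B \<alpha>) = 0"
proof -
  let ?y = "supp_elt X u v"
  let ?T = "tangent_vector X u"
  have "M1 L X u v B \<alpha> = 1/4 * vert B (vert B (vert (?T \<alpha>) Q)) (X u) ?y" for \<alpha>
    using cartan_contraction[OF z, of "?T \<alpha>" B B] by (simp add: M1_def tangent_vector_def)
  moreover have "vert B (vert B (vert (?T \<alpha>) Q)) (X u) ?y = vert (?T \<alpha>) (vert B (vert B Q)) (X u) ?y" for \<alpha>
  proof -
    have "vert B (vert B (vert (?T \<alpha>) Q)) (X u) ?y = vert B (vert (?T \<alpha>) (vert B Q)) (X u) ?y"
      by (rule dirder_cong[OF _ z]) (simp add: dirder_commute[of Q])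
    also have "\<dots> = vert (?T \<alpha>) (vert B (vert B Q)) (X u) ?y"
      by (rule dirder_commute[OF _ z]) simp
    finally show ?thesis .
  qed
  ultimately have M1: "M1 L X u v B \<alpha> = 1/4 * vert (?T \<alpha>) (vert B (vert B Q)) (X u) ?y" for \<alpha>
    by simp
  have "(\<Sum>\<alpha>\<in>UNIV. v $ \<alpha> * M1 L X u v B \<alpha>) = 1/4 * vert ?y (vert B (vert B Q)) (X u) ?y"
    unfolding M1 by (simp add: vert_supp_elt[OF z] sum_divide_distrib)
  moreover have "homogeneous (2 - 1 - 1) (vert B (vert B Q))"
    by (intro homogeneous_vert homogeneous_Q) simp_all
  then have "vert ?y (vert B (vert B Q)) (X u) ?y = 0" using z by (simp add: homogeneous_def)
  ultimately show ?thesis by simp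
qed

lemma normal_curvature_supporting:
  assumes z: "(X u, supp_elt X u v) \<in> D"
  shows "(\<Sum>\<alpha>\<in>UNIV. v $ \<alpha> * normal_curvature L X u v B \<alpha> \<gamma>) = H1 L X u v B \<gamma>"
proof -
  let ?y = "supp_elt X u v"
  let ?F = "\<lambda>i j k. cartan_F L i j k (X u) ?y"
  have F: "(\<Sum>\<alpha>\<in>UNIV. v $ \<alpha> * (\<Sum>j\<in>UNIV. \<Sum>k\<in>UNIV. ?F i j k * proj X j \<alpha> u * proj X k \<gamma> u))
      = (\<Sum>k\<in>UNIV. spray_conn L i k (X u) ?y * proj X k \<gamma> u)" for i
  proof -
    have "(\<Sum>\<alpha>\<in>UNIV. v $ \<alpha> * (\<Sum>j\<in>UNIV. \<Sum>k\<in>UNIV. ?F i j k * proj X j \<alpha> u * proj X k \<gamma> u))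
        = (\<Sum>\<alpha>\<in>UNIV. \<Sum>j\<in>UNIV. \<Sum>k\<in>UNIV. proj X k \<gamma> u * (?F i j k * (proj X j \<alpha> u * v $ \<alpha>)))"
      by (simp add: sum_distrib_left mult_ac)
    also have "\<dots> = (\<Sum>k\<in>UNIV. proj X k \<gamma> u * (\<Sum>j\<in>UNIV. ?F i j k * ?y $ j))"
      by (subst sum_reverse3) (simp add: supp_elt_def sum_distrib_left)
    finally show ?thesis unfolding cartan_F_supporting[OF z] by (simp only: mult.commute)
  qed
  have "(\<Sum>\<alpha>\<in>UNIV. v $ \<alpha> * normal_curvature L X u v B \<alpha> \<gamma>)
      = (\<Sum>i\<in>UNIV. normal_low L X u v B i * (\<Sum>\<alpha>\<in>UNIV. v $ \<alpha> * (proj2 X i \<alpha> \<gamma> u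
        + (\<Sum>j\<in>UNIV. \<Sum>k\<in>UNIV. ?F i j k * proj X j \<alpha> u * proj X k \<gamma> u))))"
    unfolding normal_curvature_def sum_distrib_left[of "_ $ _"] sum_distrib_left[of "normal_low _ _ _ _ _ _"]
    by (subst sum.swap) (simp only: mult_ac)
  also have "\<dots> = H1 L X u v B \<gamma>"
    by (simp only: distrib_left sum.distrib F H1_def) (simp add: mult.commute)
  finally show ?thesis .
qed

text \<open>Contracting \<open>H\<^sub>\<alpha>\<^sub>\<gamma> = 0\<close> with \<open>v\<^sup>\<alpha>\<close> isolates \<open>H\<^sub>\<gamma>\<close>, after which the product \<open>M\<^sub>\<alpha> H\<^sub>\<gamma>\<close> is zero.\<close>
lemma H2_vanishes_iff:
  assumes z: "(X u, supp_elt X u v) \<in> D"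
  shows "(\<forall>\<alpha> \<gamma>. H2 L X u v B \<alpha> \<gamma> = 0) \<longleftrightarrow>
    (\<forall>\<alpha>. H1 L X u v B \<alpha> = 0) \<and> (\<forall>\<alpha> \<gamma>. normal_curvature L X u v B \<alpha> \<gamma> = 0)"
proof
  assume H2: "\<forall>\<alpha> \<gamma>. H2 L X u v B \<alpha> \<gamma> = 0"
  have "H1 L X u v B \<gamma> = 0" for \<gamma>
  proof -
    have "0 = (\<Sum>\<alpha>\<in>UNIV. v $ \<alpha> * H2 L X u v B \<alpha> \<gamma>)" using H2 by simp
    also have "\<dots> = (\<Sum>\<alpha>\<in>UNIV. v $ \<alpha> * normal_curvature L X u v B \<alpha> \<gamma>)
        + (\<Sum>\<alpha>\<in>UNIV. v $ \<alpha> * M1 L X u v B \<alpha>) * H1 L X u v B \<gamma>"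
      by (simp add: H2_eq distrib_left sum.distrib sum_distrib_right mult.assoc)
    also have "\<dots> = H1 L X u v B \<gamma>"
      by (simp add: normal_curvature_supporting[OF z] M1_supporting[OF z])
    finally show ?thesis by simp
  qed
  with H2 show "(\<forall>\<alpha>. H1 L X u v B \<alpha> = 0) \<and> (\<forall>\<alpha> \<gamma>. normal_curvature L X u v B \<alpha> \<gamma> = 0)"
    by (simp add: H2_eq)
qed (simp add: H2_eq)

text \<open>The Cartan connection is eliminated by \<open>cartan_F_lowered\<close>.  In this form the metric enters only
  through the lowered normal and \<open>Q\<^sub>r\<close>, both of which can be compared between the two spaces.\<close>
lemma normal_curvature_eq:
  assumes z: "(X u, supp_elt X u v) \<in> D"
  shows "normal_curvature L X u v B \<alpha> \<gamma> = (\<Sum>i\<in>UNIV. normal_low L X u v B i *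
      (proj2 X i \<alpha> \<gamma> u
        + vert (tangent_vector X u \<gamma>) (vert (tangent_vector X u \<alpha>) (G i)) (X u) (supp_elt X u v)))
    + 1/4 * (\<Sum>r\<in>UNIV. pdy r Q (X u) (supp_elt X u v) *
      vert B (vert (tangent_vector X u \<gamma>) (vert (tangent_vector X u \<alpha>) (G r))) (X u) (supp_elt X u v))"
proof -
  let ?y = "supp_elt X u v"
  let ?n = "normal_low L X u v B"
  let ?s = "\<lambda>j. proj X j \<alpha> u" and ?t = "\<lambda>k. proj X k \<gamma> u"
  let ?P = "\<lambda>r j k. pdy k (pdy j (G r))"
  have lower: "(\<Sum>i\<in>UNIV. ?n i * h i) = (\<Sum>m\<in>UNIV. B $ m * (\<Sum>i\<in>UNIV. g m i (X u) ?y * h i))" for h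
  proof -
    have "(\<Sum>i\<in>UNIV. ?n i * h i) = (\<Sum>i\<in>UNIV. \<Sum>m\<in>UNIV. B $ m * (g m i (X u) ?y * h i))"
      by (simp add: normal_low_def sum_distrib_left sum_distrib_right mult_ac metric_sym[OF z])
    then show ?thesis by (subst (asm) sum.swap) (simp add: sum_distrib_left)
  qed
  have F: "(\<Sum>i\<in>UNIV. ?n i * cartan_F L i j k (X u) ?y)
      = (\<Sum>r\<in>UNIV. ?n r * ?P r j k (X u) ?y) + (\<Sum>r\<in>UNIV. 1/4 * pdy r Q (X u) ?y * vert B (?P r j k) (X u) ?y)"
    for j k
  proof -
    have "(\<Sum>i\<in>UNIV. ?n i * cartan_F L i j k (X u) ?y)
        = (\<Sum>m\<in>UNIV. B $ m * (\<Sum>r\<in>UNIV. g m r (X u) ?y * ?P r j k (X u) ?y))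
        + (\<Sum>m\<in>UNIV. \<Sum>r\<in>UNIV. 1/4 * pdy r Q (X u) ?y * (B $ m * pdy m (?P r j k) (X u) ?y))"
      unfolding lower cartan_F_lowered[OF z]
      by (simp add: distrib_left sum.distrib sum_distrib_left mult_ac)
    also have "(\<Sum>m\<in>UNIV. \<Sum>r\<in>UNIV. 1/4 * pdy r Q (X u) ?y * (B $ m * pdy m (?P r j k) (X u) ?y))
        = (\<Sum>r\<in>UNIV. 1/4 * pdy r Q (X u) ?y * vert B (?P r j k) (X u) ?y)"
      using z by (subst sum.swap) (simp add: vertical_dirder sum_distrib_left sum_divide_distrib)
    finally show ?thesis by (simp only: lower)
  qed
  have P: "(\<Sum>j\<in>UNIV. \<Sum>k\<in>UNIV. ?P r j k x y * ?s j * ?t k)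
      = vert (tangent_vector X u \<gamma>) (vert (tangent_vector X u \<alpha>) (G r)) x y" if "(x, y) \<in> D" for r x y
    using that by (subst sum.swap) (simp add: vert_vert tangent_vector_def mult_ac)
  have BP: "(\<Sum>j\<in>UNIV. \<Sum>k\<in>UNIV. vert B (?P r j k) (X u) ?y * ?s j * ?t k)
      = vert B (vert (tangent_vector X u \<gamma>) (vert (tangent_vector X u \<alpha>) (G r))) (X u) ?y" for r
  proof -
    have "vert B (vert (tangent_vector X u \<gamma>) (vert (tangent_vector X u \<alpha>) (G r))) (X u) ?y
        = vert B (\<lambda>x y. \<Sum>j\<in>UNIV. \<Sum>k\<in>UNIV. ?P r j k x y * ?s j * ?t k) (X u) ?y"
      by (rule dirder_cong[OF P[symmetric] z])
    then show ?thesis using z by (simp add: dirder_sum dirder_mult dirder_const)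
  qed
  have "(\<Sum>i\<in>UNIV. ?n i * (\<Sum>j\<in>UNIV. \<Sum>k\<in>UNIV. cartan_F L i j k (X u) ?y * ?s j * ?t k))
      = (\<Sum>j\<in>UNIV. \<Sum>k\<in>UNIV. ?s j * ?t k * (\<Sum>i\<in>UNIV. ?n i * cartan_F L i j k (X u) ?y))"
    by (rule sum_pull_out)
  also have "\<dots> = (\<Sum>j\<in>UNIV. \<Sum>k\<in>UNIV. ?s j * ?t k * (\<Sum>r\<in>UNIV. ?n r * ?P r j k (X u) ?y))
      + (\<Sum>j\<in>UNIV. \<Sum>k\<in>UNIV. ?s j * ?t k * (\<Sum>r\<in>UNIV. 1/4 * pdy r Q (X u) ?y * vert B (?P r j k) (X u) ?y))"
    unfolding F by (simp only: distrib_left sum.distrib)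
  also have "\<dots> = (\<Sum>r\<in>UNIV. ?n r * vert (tangent_vector X u \<gamma>) (vert (tangent_vector X u \<alpha>) (G r)) (X u) ?y)
      + (\<Sum>r\<in>UNIV. 1/4 * pdy r Q (X u) ?y *
          vert B (vert (tangent_vector X u \<gamma>) (vert (tangent_vector X u \<alpha>) (G r))) (X u) ?y)"
    unfolding sum_pull_out[symmetric] BP P[OF z] ..
  finally show ?thesis
    unfolding normal_curvature_def by (simp add: distrib_left sum.distrib sum_distrib_left mult_ac)
qed

text \<open>The \<open>n - 1\<close> independent tangent vectors and \<open>B\<close> span the whole space.  Subtracting from \<open>C\<close> its
  component along \<open>B\<close> leaves a vector orthogonal to all of them, hence zero.\<close>
lemma normal_line:
  fixes X :: "real^'m::finite \<Rightarrow> real^'k"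
  assumes z: "(X u, supp_elt X u v) \<in> D"
    and card: "CARD('k) = CARD('m) + 1"
    and rank: "rank (\<chi> i \<alpha>. proj X i \<alpha> u :: real^'m^'k) = CARD('m)"
    and B: "B \<noteq> 0" "\<And>\<alpha>. vert (tangent_vector X u \<alpha>) (vert B Q) (X u) (supp_elt X u v) = 0"
    and C: "\<And>\<alpha>. vert (tangent_vector X u \<alpha>) (vert C Q) (X u) (supp_elt X u v) = 0"
  obtains c where "C = c *\<^sub>R B"
proof -
  define m :: "real^'k \<Rightarrow> real^'k \<Rightarrow> real" where
    "m a w = (\<Sum>i\<in>UNIV. \<Sum>j\<in>UNIV. g i j (X u) (supp_elt X u v) * a $ i * w $ j)" for a w
  have m_eq: "m a w = 1/2 * vert a (vert w Q) (X u) (supp_elt X u v)" for a w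
    unfolding m_def by (rule metric_pairing[OF z])
  have pos: "m w w > 0" if "w \<noteq> 0" for w unfolding m_def by (rule metric_pos[OF z that])
  have sub: "subspace {a. m a w = 0}" for w
    by (auto simp: subspace_def m_def algebra_simps sum.distrib simp flip: sum_distrib_left)
  define S where "S = range (tangent_vector X u)"
  have "S = columns (\<chi> i \<alpha>. proj X i \<alpha> u :: real^'m^'k)"
    by (auto simp: S_def columns_def column_def tangent_vector_def)
  then have dimS: "dim S = CARD('m)" using rank by (simp add: column_rank_def)
  have "span S \<subseteq> {a. m a B = 0}"
    by (rule span_minimal[OF _ sub]) (use B(2) in \<open>auto simp: S_def m_eq\<close>)
  then have "B \<notin> span S" using pos[OF B(1)] by auto
  then have "dim (insert B S) = DIM(real^'k)" using dimS card by (simp add: dim_insert)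
  then have full: "span (insert B S) = UNIV" by (simp only: dim_eq_full)
  define c where "c = m B C / m B B"
  define w where "w = C - c *\<^sub>R B"
  have mw: "m a w = m a C - c * m a B" for a
    by (simp add: m_def w_def algebra_simps sum_subtractf sum_distrib_left)
  have "span (insert B S) \<subseteq> {a. m a w = 0}"
  proof (rule span_minimal[OF _ sub])
    have "m B w = 0" using pos[OF B(1)] by (simp add: mw c_def)
    moreover have "m (tangent_vector X u \<alpha>) w = 0" for \<alpha>
      unfolding mw by (simp add: m_eq B(2) C)
    ultimately show "insert B S \<subseteq> {a. m a w = 0}" by (auto simp: S_def)
  qed
  then have "m w w = 0" using full by auto
  then have "w = 0" using pos by force
  then show ?thesis using that[of c] by (simp add: w_def)
qed

text \<open>A condition that ignores scaling may be tested on any one normal vector, of whatever length.  This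
  allows the same vector to be used for both metrics.\<close>
lemma all_unit_normals_iff:
  fixes X :: "real^'m::finite \<Rightarrow> real^'k"
  assumes z: "(X u, supp_elt X u v) \<in> D"
    and card: "CARD('k) = CARD('m) + 1"
    and rank: "rank (\<chi> i \<alpha>. proj X i \<alpha> u :: real^'m^'k) = CARD('m)"
    and B: "B \<noteq> 0" "\<And>\<alpha>. vert (tangent_vector X u \<alpha>) (vert B Q) (X u) (supp_elt X u v) = 0"
    and P: "\<And>c B. c \<noteq> 0 \<Longrightarrow> P (c *\<^sub>R B) \<longleftrightarrow> P B"
  shows "(\<forall>C. unit_normal L X u v C \<longrightarrow> P C) \<longleftrightarrow> P B"
proof -
  have eq: "P C \<longleftrightarrow> P B" if C: "unit_normal L X u v C" for C
  proof -
    have "vert (tangent_vector X u \<alpha>) (vert C Q) (X u) (supp_elt X u v) = 0" for \<alpha>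
      using C metric_pairing[OF z, of "tangent_vector X u \<alpha>" C]
      by (simp add: unit_normal_def tangent_vector_def)
    from normal_line[OF z card rank B this] obtain c where c: "C = c *\<^sub>R B" by blast
    moreover have "C \<noteq> 0" using C by (auto simp: unit_normal_def)
    ultimately show ?thesis using P[of c B] by auto
  qed
  moreover obtain C where "unit_normal L X u v C"
    using unit_normal_exists[OF card] metric_pos[OF z] by blast
  ultimately show ?thesis by blast
qed

text \<open>The supporting element is tangent to the hypersurface, and \<open>g(y, B)\<close> is half the derivative of
  \<open>L\<^sup>2\<close> along \<open>B\<close>.\<close>
lemma normal_annihilates_L:
  assumes z: "(X u, supp_elt X u v) \<in> D"
    and B: "\<And>\<alpha>. vert (tangent_vector X u \<alpha>) (vert B Q) (X u) (supp_elt X u v) = 0"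
  shows "vert B L (X u) (supp_elt X u v) = 0"
proof -
  have "homogeneous (2 - 1) (vert B Q)" by (intro homogeneous_vert homogeneous_Q) simp
  then have "vert B Q (X u) (supp_elt X u v) = vert (supp_elt X u v) (vert B Q) (X u) (supp_elt X u v)"
    using z by (simp add: homogeneous_def)
  also have "\<dots> = 0" by (simp add: vert_supp_elt[OF z] B)
  finally show ?thesis using L_pos[OF z] by (simp add: dirder_Q[OF z])
qed

end

section \<open>The \<open>h\<close>-Matsumoto change\<close>

locale h_matsumoto_chart = parallel_h_vector_chart D L b + bar: finsler_chart D Lb
  for D :: "((real^'k::finite) \<times> (real^'k)) set" and L b Lb +
  assumes beta_neq_L: "(x, y) \<in> D \<Longrightarrow> L x y - \<beta> x y \<noteq> 0"
    and matsumoto: "(x, y) \<in> D \<Longrightarrow> Lb x y = (L x y)\<^sup>2 / (L x y - \<beta> x y)"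
begin

text \<open>The partial derivatives of \<open>Qb = (L\<^sup>2 / (L - \<beta>))\<^sup>2\<close> with respect to \<open>L\<close> and \<open>\<beta>\<close>, with \<open>L\<^sup>2 / (L - \<beta>)\<close>
  written as \<open>Lb\<close>.\<close>
definition dL_Qb :: "'k scalar" where
  "dL_Qb = (\<lambda>x y. 2 * Lb x y * (2 * L x y - Lb x y) / (L x y - \<beta> x y))"

definition d\<beta>_Qb :: "'k scalar" where
  "d\<beta>_Qb = (\<lambda>x y. 2 * Lb x y * Lb x y / (L x y - \<beta> x y))"

lemma smooth_dL_Qb: "smooth_scalar D dL_Qb" and smooth_d\<beta>_Qb: "smooth_scalar D d\<beta>_Qb"
  unfolding dL_Qb_def d\<beta>_Qb_def by (intro smooth_scalar_divide beta_neq_L; simp)+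

lemma bar_Q_derivative:
  assumes z: "(x, y) \<in> D"
  shows "dirder w bar.Q x y = dL_Qb x y * dirder w L x y + d\<beta>_Qb x y * dirder w \<beta> x y"
proof -
  have "dirder w (\<lambda>x y. Lb x y * (L x y - \<beta> x y)) x y = dirder w (\<lambda>x y. (L x y)\<^sup>2) x y"
    by (rule dirder_cong[OF _ z]) (use beta_neq_L in \<open>auto simp: matsumoto\<close>)
  then have "dirder w Lb x y * (L x y - \<beta> x y)
      = (2 * L x y - Lb x y) * dirder w L x y + Lb x y * dirder w \<beta> x y"
    using z by (simp add: dirder_mult dirder_diff dirder_Q algebra_simps)
  then have e: "dirder w Lb x y
      = ((2 * L x y - Lb x y) * dirder w L x y + Lb x y * dirder w \<beta> x y) / (L x y - \<beta> x y)"
    using beta_neq_L[OF z] by (simp add: nonzero_eq_divide_eq)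
  show ?thesis
    unfolding bar.dirder_Q[OF z] e dL_Qb_def d\<beta>_Qb_def
    by (simp add: add_divide_distrib diff_divide_distrib algebra_simps)
qed

text \<open>A function of \<open>L\<close> and \<open>\<beta>\<close> is horizontally constant for the spray of \<open>L\<close>, since \<open>L\<close> and \<open>\<beta>\<close> are;
  by \<open>spray_unique\<close> this spray is that of \<open>Lb\<close>.\<close>
lemma bar_spray:
  assumes z: "(x, y) \<in> D"
  shows "bar.G i x y = G i x y"
proof (rule bar.spray_unique[OF smooth_spray homogeneous_spray _ z])
  fix x y k assume z: "(x, y) \<in> D"
  have "pdx k bar.Q x y = dL_Qb x y * pdx k L x y + d\<beta>_Qb x y * pdx k \<beta> x y"
    unfolding pdx_eq_dirder by (rule bar_Q_derivative[OF z])
  moreover have "pdy r bar.Q x y = dL_Qb x y * pdy r L x y + d\<beta>_Qb x y * pdy r \<beta> x y" for r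
    unfolding pdy_eq_dirder by (rule bar_Q_derivative[OF z])
  ultimately show "pdx k bar.Q x y = (\<Sum>r\<in>UNIV. pdy k (G r) x y * pdy r bar.Q x y)"
    using horizontally_constant_L horizontally_constant_beta z
    by (simp add: horizontally_constant_def spray_conn_def sum_distrib_left sum.distrib algebra_simps)
qed

lemma bar_normal:
  assumes z: "(x, y) \<in> D" and BL: "vert B L x y = 0" and B\<beta>: "vert B \<beta> x y = 0" and B: "B \<noteq> 0"
  obtains \<tau> where "\<tau> > 0"
    and "\<And>U. vert U (vert B bar.Q) x y = \<tau> * vert U (vert B Q) x y"
    and "\<And>T U. vert T (vert B Q) x y = 0 \<Longrightarrow> vert U (vert B Q) x y = 0 \<Longrightarrow>
      vert U (vert T (vert B bar.Q)) x y = \<tau> * vert U (vert T (vert B Q)) x y"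
    and "\<And>T U. vert U (vert B Q) x y = 0 \<Longrightarrow>
      (\<Sum>r\<in>UNIV. pdy r bar.Q x y * vert B (vert U (vert T (G r))) x y)
      = \<tau> * (\<Sum>r\<in>UNIV. pdy r Q x y * vert B (vert U (vert T (G r))) x y)"
proof -
  have L0: "L x y > 0" by (rule L_pos[OF z])
  obtain \<rho> where \<rho>: "\<And>U W. vert U (vert W \<beta>) x y = \<rho> * vert U (vert W L) x y"
    using hessian_beta[OF z] by blast
  have Q_grad: "pdy i Q x y = 2 * L x y * pdy i L x y + 0 * pdy i \<beta> x y" if "(x, y) \<in> D" for x y i
    using that by (simp add: pdy_eq_dirder dirder_Q)
  have bar_grad: "pdy i bar.Q x y = dL_Qb x y * pdy i L x y + d\<beta>_Qb x y * pdy i \<beta> x y" if "(x, y) \<in> D" for x y i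
    unfolding pdy_eq_dirder by (rule bar_Q_derivative[OF that])
  have sm: "smooth_scalar D (\<lambda>x y. 2 * L x y)" "smooth_scalar D (\<lambda>x y. 0)"
    "smooth_scalar D Q" "smooth_scalar D bar.Q" by simp_all
  have QB: "vert B (vert B Q) x y > 0" "vert B (vert B bar.Q) x y > 0"
    using metric_pos[OF z B] metric_pairing[OF z, of B B]
      bar.metric_pos[OF z B] bar.metric_pairing[OF z, of B B] by simp_all
  have Q2: "vert U (vert B Q) x y = 2 * L x y * vert U (vert B L) x y" for U
  proof -
    have "vert U (vert B Q) x y = vert U (\<lambda>x y. 2 * (L x y * vert B L x y)) x y"
      by (rule dirder_cong[OF _ z]) (simp add: dirder_Q)
    then show ?thesis using z BL by (simp add: dirder_cmult dirder_mult)
  qed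
  then have BB: "vert B (vert B L) x y \<noteq> 0" using QB(1) by auto
  note args = z BL B\<beta> BB \<rho>
  \<comment> \<open>The factors \<open>p + s \<rho>\<close> for \<open>Qb\<close> and for \<open>Q\<close> are \<open>\<kappa>\<close> and \<open>2 L\<close>; \<open>\<tau>\<close> is their quotient.\<close>
  define \<kappa> where "\<kappa> = dL_Qb x y + d\<beta>_Qb x y * \<rho>"
  define \<tau> where "\<tau> = \<kappa> / (2 * L x y)"
  have \<kappa>: "\<kappa> = \<tau> * (2 * L x y)" using L0 by (simp add: \<tau>_def)
  have h: "vert U (vert B bar.Q) x y = \<tau> * vert U (vert B Q) x y" for U
    using normal_hessian[OF smooth_dL_Qb smooth_d\<beta>_Qb sm(4) bar_grad args, of U]
    by (simp add: Q2 \<kappa>[unfolded \<kappa>_def])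
  have t: "vert U (vert T (vert B bar.Q)) x y = \<tau> * vert U (vert T (vert B Q)) x y"
    if "vert T (vert B Q) x y = 0" "vert U (vert B Q) x y = 0" for T U
  proof -
    have TU: "vert T (vert B L) x y = 0" "vert U (vert B L) x y = 0"
      using that L0 by (simp_all add: Q2)
    show ?thesis
      using normal_third_derivative[OF smooth_dL_Qb smooth_d\<beta>_Qb sm(4) bar_grad args TU]
        normal_third_derivative[OF sm(1,2,3) Q_grad args TU]
      by (simp add: \<kappa>[unfolded \<kappa>_def])
  qed
  have c: "(\<Sum>r\<in>UNIV. pdy r bar.Q x y * vert B (vert U (vert T (G r))) x y)
      = \<tau> * (\<Sum>r\<in>UNIV. pdy r Q x y * vert B (vert U (vert T (G r))) x y)"
    if "vert U (vert B Q) x y = 0" for T U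
  proof -
    have "vert U (vert B L) x y = 0" using that L0 by (simp add: Q2)
    then have U: "vert B (vert U L) x y = 0" using dirder_commute[OF smooth_L z] by metis
    show ?thesis
      using normal_connection_term[OF smooth_dL_Qb smooth_d\<beta>_Qb sm(4) bar_grad args U]
        normal_connection_term[OF sm(1,2,3) Q_grad args U]
      by (simp add: \<kappa>[unfolded \<kappa>_def])
  qed
  have "\<tau> > 0" using h[of B] QB by (simp add: zero_less_mult_iff)
  then show ?thesis using h t c by (rule that)
qed

text \<open>All conditions are tested on one vector \<open>B\<close>, the unit normal for \<open>L\<close>.  It is normal for \<open>Lb\<close> too, and
  there every quantity that is linear in the normal is multiplied by the same \<open>\<tau> > 0\<close>.\<close>
lemma hyperplane_conditions_agree:
  fixes X :: "real^'m::finite \<Rightarrow> real^'k"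
  assumes z: "(X u, supp_elt X u v) \<in> D"
    and card: "CARD('k) = CARD('m) + 1"
    and rank: "rank (\<chi> i \<alpha>. proj X i \<alpha> u :: real^'m^'k) = CARD('m)"
    and tangent: "\<And>B. unit_normal L X u v B \<Longrightarrow> (\<Sum>i\<in>UNIV. b i (X u) (supp_elt X u v) * B $ i) = 0"
  shows "(\<forall>B. unit_normal Lb X u v B \<longrightarrow> (\<forall>\<alpha> \<gamma>. H2 Lb X u v B \<alpha> \<gamma> = 0)) \<longleftrightarrow>
      (\<forall>B. unit_normal L X u v B \<longrightarrow> (\<forall>\<alpha> \<gamma>. H2 L X u v B \<alpha> \<gamma> = 0))" (is ?second)
    and "(\<forall>B. unit_normal Lb X u v B \<longrightarrow> (\<forall>\<alpha> \<gamma>. H2 Lb X u v B \<alpha> \<gamma> = 0 \<and> M2 Lb X u v B \<alpha> \<gamma> = 0)) \<longleftrightarrow>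
      (\<forall>B. unit_normal L X u v B \<longrightarrow> (\<forall>\<alpha> \<gamma>. H2 L X u v B \<alpha> \<gamma> = 0 \<and> M2 L X u v B \<alpha> \<gamma> = 0))" (is ?third)
proof -
  let ?y = "supp_elt X u v"
  let ?T = "tangent_vector X u"
  obtain B where B: "unit_normal L X u v B"
    using unit_normal_exists[OF card] metric_pos[OF z] by blast
  have B0: "B \<noteq> 0" using B by (auto simp: unit_normal_def)
  have BT: "vert (?T \<alpha>) (vert B Q) (X u) ?y = 0" for \<alpha>
    using B metric_pairing[OF z, of "?T \<alpha>" B] by (simp add: unit_normal_def tangent_vector_def)
  have BL: "vert B L (X u) ?y = 0" using normal_annihilates_L[OF z BT] .
  have B\<beta>: "vert B \<beta> (X u) ?y = 0"
    using tangent[OF B] z by (simp add: vertical_dirder pdy_beta mult.commute)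
  obtain \<tau> where \<tau>: "\<tau> > 0"
    and h: "\<And>U. vert U (vert B bar.Q) (X u) ?y = \<tau> * vert U (vert B Q) (X u) ?y"
    and t: "\<And>T U. vert T (vert B Q) (X u) ?y = 0 \<Longrightarrow> vert U (vert B Q) (X u) ?y = 0 \<Longrightarrow>
      vert U (vert T (vert B bar.Q)) (X u) ?y = \<tau> * vert U (vert T (vert B Q)) (X u) ?y"
    and k: "\<And>T U. vert U (vert B Q) (X u) ?y = 0 \<Longrightarrow>
      (\<Sum>r\<in>UNIV. pdy r bar.Q (X u) ?y * vert B (vert U (vert T (G r))) (X u) ?y)
      = \<tau> * (\<Sum>r\<in>UNIV. pdy r Q (X u) ?y * vert B (vert U (vert T (G r))) (X u) ?y)"
    using bar_normal[OF z BL B\<beta> B0] by blast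
  have BT': "vert (?T \<alpha>) (vert B bar.Q) (X u) ?y = 0" for \<alpha> by (simp add: h BT)
  have G1: "vert T (bar.G i) x y = vert T (G i) x y" if "(x, y) \<in> D" for T i x y
    by (rule dirder_cong[OF bar_spray that])
  have G2: "vert U (vert T (bar.G i)) x y = vert U (vert T (G i)) x y" if "(x, y) \<in> D" for T U i x y
    by (rule dirder_cong[OF G1 that])
  have G3: "vert W (vert U (vert T (bar.G i))) x y = vert W (vert U (vert T (G i))) x y"
    if "(x, y) \<in> D" for T U W i x y
    by (rule dirder_cong[OF G2 that])
  have nl: "normal_low Lb X u v B i = \<tau> * normal_low L X u v B i" for i
    unfolding normal_low_eq[OF z] bar.normal_low_eq[OF z] pdy_eq_dirder[of i] by (simp add: h)
  have H1: "H1 Lb X u v B \<alpha> = \<tau> * H1 L X u v B \<alpha>" for \<alpha>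
    unfolding H1_eq[OF z] bar.H1_eq[OF z] nl G1[OF z] by (simp add: sum_distrib_left mult.assoc)
  have nc: "normal_curvature Lb X u v B \<alpha> \<gamma> = \<tau> * normal_curvature L X u v B \<alpha> \<gamma>" for \<alpha> \<gamma>
    unfolding normal_curvature_eq[OF z] bar.normal_curvature_eq[OF z] nl G2[OF z] G3[OF z] k[OF BT]
    by (simp add: sum_distrib_left distrib_left mult.assoc)
  have M2: "M2 Lb X u v B \<alpha> \<gamma> = \<tau> * M2 L X u v B \<alpha> \<gamma>" for \<alpha> \<gamma>
    unfolding M2_eq[OF z] bar.M2_eq[OF z] t[OF BT BT] by simp
  have H2: "(\<forall>\<alpha> \<gamma>. H2 Lb X u v B \<alpha> \<gamma> = 0) \<longleftrightarrow> (\<forall>\<alpha> \<gamma>. H2 L X u v B \<alpha> \<gamma> = 0)"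
    unfolding H2_vanishes_iff[OF z] bar.H2_vanishes_iff[OF z] H1 nc using \<tau> by simp
  have scale: "(\<forall>\<alpha> \<gamma>. H2 L X u v (c *\<^sub>R C) \<alpha> \<gamma> = 0) \<longleftrightarrow> (\<forall>\<alpha> \<gamma>. H2 L X u v C \<alpha> \<gamma> = 0)"
    "(\<forall>\<alpha> \<gamma>. H2 Lb X u v (c *\<^sub>R C) \<alpha> \<gamma> = 0) \<longleftrightarrow> (\<forall>\<alpha> \<gamma>. H2 Lb X u v C \<alpha> \<gamma> = 0)"
    if "c \<noteq> 0" for c C
    unfolding H2_vanishes_iff[OF z] bar.H2_vanishes_iff[OF z] H1_scaleR normal_curvature_scaleR
    using that by simp_all
  note all_L = all_unit_normals_iff[OF z card rank B0 BT]
  note all_Lb = bar.all_unit_normals_iff[OF z card rank B0 BT']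
  have "(\<forall>C. unit_normal L X u v C \<longrightarrow> (\<forall>\<alpha> \<gamma>. H2 L X u v C \<alpha> \<gamma> = 0)) \<longleftrightarrow> (\<forall>\<alpha> \<gamma>. H2 L X u v B \<alpha> \<gamma> = 0)"
    using scale(1) by (rule all_L)
  moreover have "(\<forall>C. unit_normal Lb X u v C \<longrightarrow> (\<forall>\<alpha> \<gamma>. H2 Lb X u v C \<alpha> \<gamma> = 0)) \<longleftrightarrow> (\<forall>\<alpha> \<gamma>. H2 Lb X u v B \<alpha> \<gamma> = 0)"
    using scale(2) by (rule all_Lb)
  ultimately show ?second using H2 by blast
  let ?P = "\<lambda>F C. (\<forall>\<alpha> \<gamma>. H2 F X u v C \<alpha> \<gamma> = 0) \<and> (\<forall>\<alpha> \<gamma>. M2 F X u v C \<alpha> \<gamma> = 0)"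
  have third_L: "(\<forall>C. unit_normal L X u v C \<longrightarrow> ?P L C) \<longleftrightarrow> ?P L B"
    by (rule all_L) (simp add: scale(1) M2_scaleR)
  have third_Lb: "(\<forall>C. unit_normal Lb X u v C \<longrightarrow> ?P Lb C) \<longleftrightarrow> ?P Lb B"
    by (rule all_Lb) (simp add: scale(2) M2_scaleR)
  have "?P Lb B \<longleftrightarrow> ?P L B" using H2 M2 \<tau> by simp
  then show ?third unfolding all_conj_distrib third_L third_Lb .
qed

end

section \<open>From charts to the manifold\<close>

lemma finsler_chart_of_fundamental_function:
  assumes "conic_domain A D" "fundamental_function A D L" "c \<in> A"
  shows "finsler_chart (D c) (L c)"
proof -
  have open_D: "open (D c)" using assms(1,3) by (auto simp: conic_domain_def)
  interpret tangent_domain "D c" by unfold_locales (rule open_D)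
  have L: "smooth_on (D c) (\<lambda>(x, y). L c x y)"
    "\<And>x y. (x, y) \<in> D c \<Longrightarrow> L c x y > 0"
    "\<And>x y t. (x, y) \<in> D c \<Longrightarrow> t > 0 \<Longrightarrow> L c x (t *\<^sub>R y) = t * L c x y"
    "\<And>x y w. (x, y) \<in> D c \<Longrightarrow> w \<noteq> 0 \<Longrightarrow>
      (\<Sum>i\<in>UNIV. \<Sum>j\<in>UNIV. metric_g (L c) i j x y * w $ i * w $ j) > 0"
    using assms(2,3) unfolding fundamental_function_def by blast+
  have "dirder (0, y) (L c) x y = L c x y" if z: "(x, y) \<in> D c" for x y
  proof -
    \<comment> \<open>Euler's identity is the derivative of \<open>L(x, (1 + t) y) = (1 + t) L(x, y)\<close> at \<open>t = 0\<close>.\<close>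
    have "\<forall>\<^sub>F t in nhds (0::real). t > -1"
      using eventually_nhds_in_open[of "{-1<..}" "0::real"] by simp
    then have "\<forall>\<^sub>F t in nhds 0. L c x (y + t *\<^sub>R y) = (1 + t) * L c x y"
    proof eventually_elim
      case (elim t)
      then show ?case using L(3)[OF z, of "1 + t"] by (simp add: scaleR_add_left)
    qed
    then have "deriv (\<lambda>t. L c x (y + t *\<^sub>R y)) 0 = deriv (\<lambda>t. (1 + t) * L c x y) 0"
      by (intro deriv_cong_ev) auto
    also have "\<dots> = L c x y" by (intro DERIV_imp_deriv) (auto intro!: derivative_eq_intros)
    finally show ?thesis by (simp add: dirder_def)
  qed
  then show ?thesis
    using L by unfold_locales (auto simp: homogeneous_def smooth_scalar_def case_prod_beta')
qed

lemma h_matsumoto_chart_intro: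
  assumes F: "finsler_space M A D L" and h: "h_vector A D L b"
    and Fb: "finsler_space M A D (h_matsumoto L b)"
    and neq: "\<forall>c\<in>A. \<forall>x y. (x, y) \<in> D c \<longrightarrow> L c x y - beta b c x y \<noteq> 0"
    and par: "parallel A D L b" and c: "c \<in> A"
  shows "h_matsumoto_chart (D c) (L c) (b c) (h_matsumoto L b c)"
proof -
  interpret finsler_chart "D c" "L c"
    using F finsler_chart_of_fundamental_function[OF _ _ c] by (auto simp: finsler_space_def)
  interpret bar: finsler_chart "D c" "h_matsumoto L b c"
    using Fb finsler_chart_of_fundamental_function[OF _ _ c] by (auto simp: finsler_space_def)
  interpret parallel_h_vector_chart "D c" "L c" "b c"
  proof
    show "smooth_scalar (D c) (b c i)" for i
      using h c by (auto simp: h_vector_def covector_field_def smooth_scalar_def case_prod_beta')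
    show "hcov (L c) (b c) i j x y = 0" if "(x, y) \<in> D c" for x y i j
      using par c that by (auto simp: parallel_def)
    fix x y assume z: "(x, y) \<in> D c"
    obtain \<rho> where \<rho>: "\<And>i j. L c x y * (\<Sum>h\<in>UNIV. cartan_C (L c) h i j x y * b c h x y)
        = \<rho> c x y * angular_metric (L c) i j x y"
      using h c z unfolding h_vector_def by blast
    have "pdy j (b c i) x y = \<rho> c x y * pdy j (pdy i (L c)) x y" for i j
    proof -
      have "vcov (L c) (b c) i j x y = 0" using h c z unfolding h_vector_def by blast
      then have "pdy j (b c i) x y = (\<Sum>h\<in>UNIV. cartan_C (L c) h i j x y * b c h x y)"
        by (simp add: vcov_def mult.commute)
      then have "L c x y * pdy j (b c i) x y = L c x y * (\<rho> c x y * pdy i (pdy j (L c)) x y)"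
        using \<rho>[of i j] by (simp add: angular_metric_def)
      then show ?thesis using L_pos[OF z] pdy_commute[OF smooth_L z, of i j] by simp
    qed
    then show "\<exists>\<rho>. \<forall>i j. pdy j (b c i) x y = \<rho> * pdy j (pdy i (L c)) x y" by blast
  qed
  have "\<beta> x y = beta b c x y" for x y by (simp add: \<beta>_def beta_def)
  then show ?thesis
    using neq c by unfold_locales (auto simp: h_matsumoto_def)
qed

theorem theorem4p4:
  fixes M :: "'p topology" and A :: "('p, 'n::finite) chart set"
    and D :: "('p, 'n) chart \<Rightarrow> ((real^'n) \<times> (real^'n)) set"
    and L :: "('p, 'n) chart \<Rightarrow> 'n scalar" and b :: "('p, 'n) chart \<Rightarrow> 'n \<Rightarrow> 'n scalar"
    and N :: "'q topology" and E :: "('q, 'm::finite) chart set" and f :: "'q \<Rightarrow> 'p"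
  assumes "finsler_space M A D L"
    and "h_vector A D L b"
    and "finsler_space M A D (h_matsumoto L b)"
    and "\<forall>c\<in>A. \<forall>x y. (x, y) \<in> D c \<longrightarrow> L c x y - beta b c x y \<noteq> 0"
    and "hypersurface M A N E f"
    and "parallel A D L b"
    and "tangent_to A D L b E f"
  shows "(hyperplane_second_kind A D (h_matsumoto L b) E f \<longleftrightarrow> hyperplane_second_kind A D L E f) \<and>
         (hyperplane_third_kind A D (h_matsumoto L b) E f \<longleftrightarrow> hyperplane_third_kind A D L E f)"
proof -
  have *: "((\<forall>B. unit_normal (h_matsumoto L b c) (param f c e) u v B \<longrightarrow>
        (\<forall>\<alpha> \<gamma>. H2 (h_matsumoto L b c) (param f c e) u v B \<alpha> \<gamma> = 0)) \<longleftrightarrow>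
      (\<forall>B. unit_normal (L c) (param f c e) u v B \<longrightarrow> (\<forall>\<alpha> \<gamma>. H2 (L c) (param f c e) u v B \<alpha> \<gamma> = 0))) \<and>
    ((\<forall>B. unit_normal (h_matsumoto L b c) (param f c e) u v B \<longrightarrow>
        (\<forall>\<alpha> \<gamma>. H2 (h_matsumoto L b c) (param f c e) u v B \<alpha> \<gamma> = 0 \<and>
          M2 (h_matsumoto L b c) (param f c e) u v B \<alpha> \<gamma> = 0)) \<longleftrightarrow>
      (\<forall>B. unit_normal (L c) (param f c e) u v B \<longrightarrow> (\<forall>\<alpha> \<gamma>. H2 (L c) (param f c e) u v B \<alpha> \<gamma> = 0 \<and>
          M2 (L c) (param f c e) u v B \<alpha> \<gamma> = 0)))"
    if c: "c \<in> A" and e: "e \<in> E" and uv: "(u, v) \<in> supporting D f c e" for c e u v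
  proof -
    interpret h_matsumoto_chart "D c" "L c" "b c" "h_matsumoto L b c"
      using assms(1-4,6) c by (rule h_matsumoto_chart_intro)
    have z: "(param f c e u, supp_elt (param f c e) u v) \<in> D c" and u: "u \<in> param_dom f c e"
      using uv by (auto simp: supporting_def)
    have card: "CARD('n) = CARD('m) + 1"
      and rank: "rank (\<chi> i \<alpha>. proj (param f c e) i \<alpha> u :: real^'m^'n) = CARD('m)"
      using assms(5) c e u unfolding hypersurface_def by blast+
    have "(\<Sum>i\<in>UNIV. b c i (param f c e u) (supp_elt (param f c e) u v) * B $ i) = 0"
      if "unit_normal (L c) (param f c e) u v B" for B
      using assms(7) c e uv that unfolding tangent_to_def by blast
    from hyperplane_conditions_agree[OF z card rank this] show ?thesis by blast
  qed
  have "(\<forall>(u, v)\<in>S. P u v) \<longleftrightarrow> (\<forall>u v. (u, v) \<in> S \<longrightarrow> P u v)" for S :: "((real^'m) \<times> (real^'m)) set" and P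
    by auto
  then show ?thesis
    unfolding hyperplane_second_kind_def hyperplane_third_kind_def using * by simp
qed

end
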